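(* Let $0<\epsilon<1$. Let $0<p_1<1<p_2$ be such that $\tilde\gamma(p_1)<\gamma^*$ and $\tilde\gamma(p_2)<\gamma^*$, and let $0<\delta<\min\left(\gamma^*-\tilde\gamma(p_1),\gamma^*-\tilde\gamma(p_2)\right)$. Let $\mathcal{P}$ be a property of pairs of strings, and let the integer $k\ge1$ be such that $$\max_{\ell\in[kp_1,kp_2]}\mathbb{P}\left((X_1\cdots X_k;Y_1\cdots Y_\ell)\text{ does not satisfy property }\mathcal{P}\right)\le\frac{1}{(2ek)^{2/\epsilon}},$$ the maximum being over integers $\ell$. Let $B^n_{\mathcal{P}}(\epsilon)$ be the event that for every optimal alignment $\vec r=(r_0,\dots,r_m)$ (i.e. such that $LC_n=L_n(\vec r)$), the proportion among $i=1,\dots,m$ of string pairs $(X_{(i-1)k+1}\cdots X_{ik};Y_{r_{i-1}+1}\cdots Y_{r_i})$ satisfying property $\mathcal{P}$ is at least $1-\epsilon$. Then $$\mathbb{P}\left(B^n_{\mathcal{P}}(\epsilon)\right)\ge 1-\mathbb{P}\left((A^n_{\epsilon/2,p_1,p_2})^c\right)-\exp\left(\left(H_e\left(\frac{\epsilon}{2}\right)-\ln 2\right)m\right),$$ and thus $$\mathbb{P}\left(B^n_{\mathcal{P}}(\epsilon)\right)\ge 1-\exp\left(-n\left(-\frac{1+\ln k}{k}+\frac{\delta^2\epsilon^2}{64}\right)\right)-\exp\left(\frac nk\left(H_e\left(\frac{\epsilon}{2}\right)-\ln2\right)\right),$$ for all $n=km$ ($m$ a positive integer) large enough, i.e. for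 all such $n\ge n_0(\epsilon,\delta)$ (the law of $X_1$ and $p_1,p_2$ being fixed).
   Context: Let $(X_i)_{i\ge1}$ and $(Y_i)_{i\ge1}$ be two independent iid sequences with the same non-degenerate law on a finite alphabet $\mathcal{A}$. For finite strings $x,y$, $|LCS(x;y)|$ denotes the length of a longest common subsequence (i.e. the maximal length of a string that is a, not necessarily contiguous, subsequence of both $x$ and $y$). Put $LC_n:=|LCS(X_1\cdots X_n;Y_1\cdots Y_n)|$ and $\gamma^*:=\lim_{n\to\infty}\mathbb{E}LC_n/n=\sup_{n\ge1}\mathbb{E}LC_n/n$. For $p>0$ let $$\tilde\gamma(p):=\lim_{n\to\infty}\frac{\mathbb{E}|LCS(X_1X_2\cdots X_n;Y_1Y_2\cdots Y_{np})|}{n(1+p)/2},$$ where a non-integer index $np$ is rounded up to the nearest positive integer (this limit exists, and $\tilde\gamma(1)=\gamma^*$). Throughout $n=km$ with $k,m$ positive integers. The vectors $\vec r=(r_0,r_1,\dots,r_m)$ considered are integer vectors with (I) $r_0=0<r_1<r_2<\cdots<r_{m-1}<r_m=n$, and for such $\vec r$ $$L_n(\vec r):=\sum_{i=1}^m|LCS(X_{k(i-1)+1}X_{k(i-1)+2}\cdots X_{ki};Y_{r_{i-1}+1}Y_{r_{i-1}+2}\cdots Y_{r_i})|.$$ For $\epsilon,p_1,p_2>0$, $A^n_{\epsilon,p_1,p_2}$ is the event that for every integer vector $\vec r$ satisfying (I) and $LC_n=L_n(\vec r)$, one has $\mathrm{Card}(\{i\in\{1,\dots,m\}:kp_1\le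 r_i-r_{i-1}\le kp_2\})\ge(1-\epsilon)m$; the superscript $c$ denotes complement. A property of pairs of strings is a map $\mathcal{P}:(\cup_k\mathcal{A}^k)\times(\cup_k\mathcal{A}^k)\to\{0,1\}$; the pair $(x,y)$ satisfies (has) property $\mathcal{P}$ if $\mathcal{P}(x,y)=1$. Finally $H_e(x)=-x\ln x-(1-x)\ln(1-x)$ for $0<x<1$. *)

theory Defs
  imports "HOL-Probability.Probability" "HOL-Library.Sublist"
begin

definition lcs_len :: "'a list \<Rightarrow> 'a list \<Rightarrow> nat" where
  "lcs_len x y = Max {length z | z. subseq z x \<and> subseq z y}"

text \<open>The string \<open>X\<^sub>a\<^sub>+\<^sub>1 X\<^sub>a\<^sub>+\<^sub>2 \<dots> X\<^sub>b\<close>. Sequences are indexed from 1; the value \<open>X 0\<close> is never used.\<close>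

definition word :: "(nat \<Rightarrow> 'w \<Rightarrow> 'a) \<Rightarrow> nat \<Rightarrow> nat \<Rightarrow> 'w \<Rightarrow> 'a list" where
  "word X a b \<omega> = map (\<lambda>i. X i \<omega>) [a + 1..<b + 1]"

definition LC :: "(nat \<Rightarrow> 'w \<Rightarrow> 'a) \<Rightarrow> (nat \<Rightarrow> 'w \<Rightarrow> 'a) \<Rightarrow> nat \<Rightarrow> 'w \<Rightarrow> nat" where
  "LC X Y n \<omega> = lcs_len (word X 0 n \<omega>) (word Y 0 n \<omega>)"

definition gamma_star :: "'w measure \<Rightarrow> (nat \<Rightarrow> 'w \<Rightarrow> 'a) \<Rightarrow> (nat \<Rightarrow> 'w \<Rightarrow> 'a) \<Rightarrow> real" where
  "gamma_star M X Y = lim (\<lambda>n. (\<integral>\<omega>. real (LC X Y n \<omega>) \<partial>M) / real n)"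

definition gamma_tilde :: "'w measure \<Rightarrow> (nat \<Rightarrow> 'w \<Rightarrow> 'a) \<Rightarrow> (nat \<Rightarrow> 'w \<Rightarrow> 'a) \<Rightarrow> real \<Rightarrow> real" where
  "gamma_tilde M X Y p =
     lim (\<lambda>n. (\<integral>\<omega>. real (lcs_len (word X 0 n \<omega>) (word Y 0 (nat \<lceil>real n * p\<rceil>) \<omega>)) \<partial>M)
              / (real n * (1 + p) / 2))"

text \<open>
  An integer vector \<open>(r\<^sub>0, \<dots>, r\<^sub>m)\<close> with \<open>0 = r\<^sub>0 < r\<^sub>1 < \<dots> < r\<^sub>m = n\<close> has nonnegative entries; it is
  represented by a function on the naturals of which only the values at \<open>0, \<dots>, m\<close> matter.
\<close>

definition cut_vector :: "nat \<Rightarrow> nat \<Rightarrow> (nat \<Rightarrow> nat) \<Rightarrow> bool" where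
  "cut_vector n m r \<longleftrightarrow> r 0 = 0 \<and> strict_mono_on {0..m} r \<and> r m = n"

definition L_cut ::
  "(nat \<Rightarrow> 'w \<Rightarrow> 'a) \<Rightarrow> (nat \<Rightarrow> 'w \<Rightarrow> 'a) \<Rightarrow> nat \<Rightarrow> nat \<Rightarrow> (nat \<Rightarrow> nat) \<Rightarrow> 'w \<Rightarrow> nat" where
  "L_cut X Y k m r \<omega> =
     (\<Sum>i = 1..m. lcs_len (word X (k * (i - 1)) (k * i) \<omega>) (word Y (r (i - 1)) (r i) \<omega>))"

text \<open>In the following, \<open>n = k * m\<close> throughout.\<close>

definition optimal_cut ::
  "(nat \<Rightarrow> 'w \<Rightarrow> 'a) \<Rightarrow> (nat \<Rightarrow> 'w \<Rightarrow> 'a) \<Rightarrow> nat \<Rightarrow> nat \<Rightarrow> 'w \<Rightarrow> (nat \<Rightarrow> nat) \<Rightarrow> bool" where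
  "optimal_cut X Y k m \<omega> r \<longleftrightarrow>
     cut_vector (k * m) m r \<and> LC X Y (k * m) \<omega> = L_cut X Y k m r \<omega>"

definition A_event ::
  "'w measure \<Rightarrow> (nat \<Rightarrow> 'w \<Rightarrow> 'a) \<Rightarrow> (nat \<Rightarrow> 'w \<Rightarrow> 'a) \<Rightarrow> nat \<Rightarrow> nat
     \<Rightarrow> real \<Rightarrow> real \<Rightarrow> real \<Rightarrow> 'w set" where
  "A_event M X Y k m \<epsilon> p1 p2 =
     {\<omega> \<in> space M. \<forall>r. optimal_cut X Y k m \<omega> r \<longrightarrow>
        real (card {i \<in> {1..m}. real k * p1 \<le> real (r i - r (i - 1)) \<and>
                                real (r i - r (i - 1)) \<le> real k * p2})
          \<ge> (1 - \<epsilon>) * real m}"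

definition B_event ::
  "'w measure \<Rightarrow> (nat \<Rightarrow> 'w \<Rightarrow> 'a) \<Rightarrow> (nat \<Rightarrow> 'w \<Rightarrow> 'a) \<Rightarrow> nat \<Rightarrow> nat
     \<Rightarrow> ('a list \<Rightarrow> 'a list \<Rightarrow> bool) \<Rightarrow> real \<Rightarrow> 'w set" where
  "B_event M X Y k m P \<epsilon> =
     {\<omega> \<in> space M. \<forall>r. optimal_cut X Y k m \<omega> r \<longrightarrow>
        real (card {i \<in> {1..m}. P (word X ((i - 1) * k) (i * k) \<omega>)
                                  (word Y (r (i - 1)) (r i) \<omega>)}) / real m
          \<ge> 1 - \<epsilon>}"

definition H_e :: "real \<Rightarrow> real" where
  "H_e x = - x * ln x - (1 - x) * ln (1 - x)"

end

theory Submission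
  imports Defs
begin

text \<open>
  Cutting \<open>X\<close> into \<open>m\<close> blocks of length \<open>k\<close>, there are at most \<open>(km choose m) \<le> (ek)\<^sup>m\<close> cut vectors.

  If too many optimal string pairs lack the property although \<open>A\<close> holds at level \<open>a = \<epsilon>/2\<close>, then for some
  cut vector some set of \<open>\<lceil>am\<rceil>\<close> blocks of admissible length consists of pairs without the property. Blocks
  of a fixed cut vector are independent, so with \<open>q = (2ek)\<^bsup>-1/a\<^esup>\<close> the union bound gives
  \<open>(ek)\<^sup>m (m choose \<lceil>am\<rceil>) q\<^bsup>\<lceil>am\<rceil>\<^esup> \<le> (ek)\<^sup>m exp (H\<^sub>e(a) m) (2ek)\<^bsup>-m\<^esup>\<close>.

  For the complement of \<open>A\<close>, superadditivity bounds the mean score of a string pair of shape \<open>(k, l)\<close> by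
  \<open>\<gamma>\<^sup>* (k + l) / 2\<close>, and by a strictly smaller multiple of \<open>k + l\<close> if \<open>l/k\<close> is outside \<open>[p\<^sub>1, p\<^sub>2]\<close>.
  Hence a cut vector with more than \<open>am\<close> inadmissible blocks has a mean score smaller than that of the
  optimum by at least \<open>\<delta>an/2\<close>. The difference of the two scores changes by at most \<open>2\<close> with each of the \<open>2n\<close>
  letters, and McDiarmid's inequality applies to each cut vector.
\<close>

section \<open>Longest common subsequences\<close>

lemma finite_lcs_lengths: "finite {length z | z. subseq z x \<and> subseq z y}"
proof (rule finite_subset)
  show "{length z | z. subseq z x \<and> subseq z y} \<subseteq> {..length x}"
    by (auto dest: list_emb_length)
qed simp

lemma lcs_len_ge: "subseq z x \<Longrightarrow> subseq z y \<Longrightarrow> length z \<le> lcs_len x y"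
  unfolding lcs_len_def by (intro Max_ge finite_lcs_lengths) auto

lemma lcs_len_witness:
  obtains z where "subseq z x" "subseq z y" "length z = lcs_len x y"
proof -
  have "lcs_len x y \<in> {length z | z. subseq z x \<and> subseq z y}"
    unfolding lcs_len_def by (intro Max_in finite_lcs_lengths) (auto intro: exI[of _ "[]"])
  then show ?thesis using that by auto
qed

lemma lcs_len_leI:
  assumes "\<And>z. subseq z x \<Longrightarrow> subseq z y \<Longrightarrow> length z \<le> c"
  shows "lcs_len x y \<le> c"
  using assms by (metis lcs_len_witness)

lemma lcs_len_commute: "lcs_len x y = lcs_len y x"
  unfolding lcs_len_def by (metis (no_types, lifting))

lemma lcs_len_le_length: "lcs_len x y \<le> length x"
  by (intro lcs_len_leI) (rule list_emb_length)

lemma lcs_len_append: "lcs_len x y + lcs_len x' y' \<le> lcs_len (x @ x') (y @ y')"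
proof -
  obtain z where z: "subseq z x" "subseq z y" "length z = lcs_len x y" by (rule lcs_len_witness)
  obtain z' where z': "subseq z' x'" "subseq z' y'" "length z' = lcs_len x' y'"
    by (rule lcs_len_witness)
  have "length (z @ z') \<le> lcs_len (x @ x') (y @ y')"
    using z z' by (intro lcs_len_ge list_emb_append_mono)
  then show ?thesis using z z' by simp
qed

text \<open>A common subsequence splits into a part inside \<open>y\<close>, still a subsequence of
  \<open>x\<close>, and a part inside \<open>y'\<close>. This Lipschitz bound later pays for
  rounding lengths.\<close>

lemma lcs_len_append_right: "lcs_len x (y @ y') \<le> lcs_len x y + length y'"
proof (rule lcs_len_leI)
  fix z assume z: "subseq z x" "subseq z (y @ y')"
  from z(2) obtain u v where uv: "z = u @ v" "subseq u y" "subseq v y'"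
    by (rule subseq_appendE)
  have "subseq u x"
    using z(1) uv(1) by (metis subseq_order.trans subseq_rev_drop_many subseq_order.order_refl)
  with uv have "length u \<le> lcs_len x y" by (intro lcs_len_ge)
  moreover have "length v \<le> length y'" using uv by (rule_tac list_emb_length)
  ultimately show "length z \<le> lcs_len x y + length y'" using uv by simp
qed

text \<open>Split a common subsequence along position \<open>j\<close> of \<open>x\<close>. Dropping
  the at most one letter matched there leaves a string that survives any change of
  \<open>x ! j\<close>.\<close>

lemma lcs_len_list_update: "lcs_len x y \<le> lcs_len (x[j := a]) y + 1"
proof (cases "j < length x")
  case True
  define u v where "u = take j x" and "v = drop (Suc j) x"
  have x: "x = u @ [x ! j] @ v" and x': "x[j := a] = u @ [a] @ v"
    using True by (simp_all add: u_def v_def id_take_nth_drop upd_conv_take_nth_drop)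
  show ?thesis
  proof (rule lcs_len_leI)
    fix z assume z: "subseq z x" "subseq z y"
    from z(1) obtain z1 z2 where 1: "z = z1 @ z2" "subseq z1 u" "subseq z2 ([x ! j] @ v)"
      by (subst (asm) x) (auto elim: subseq_appendE)
    from 1(3) obtain z3 z4 where 2: "z2 = z3 @ z4" "subseq z3 [x ! j]" "subseq z4 v"
      by (rule subseq_appendE)
    have "subseq (z1 @ [] @ z4) (u @ [a] @ v)"
      using 1 2 by (intro list_emb_append_mono) auto
    moreover have "subseq (z1 @ [] @ z4) (z1 @ z3 @ z4)"
      by (intro list_emb_append_mono) auto
    then have "subseq (z1 @ z4) y" using z(2) 1 2 by (auto intro: subseq_order.trans)
    ultimately have "length (z1 @ z4) \<le> lcs_len (x[j := a]) y"
      unfolding x' by (intro lcs_len_ge) auto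
    moreover have "length z3 \<le> 1" using list_emb_length[OF 2(2)] by simp
    ultimately show "length z \<le> lcs_len (x[j := a]) y + 1" using 1 2 by simp
  qed
qed (simp add: list_update_beyond)

lemma lcs_len_update_diff: "\<bar>real (lcs_len (x[j := a]) y) - real (lcs_len x y)\<bar> \<le> 1"
proof -
  have "lcs_len x y \<le> lcs_len (x[j := a]) y + 1" by (rule lcs_len_list_update)
  \<comment> \<open>Writing the old letter back undoes the update, so the one-sided bound applies in
    reverse.\<close>
  moreover have "lcs_len (x[j := a]) y \<le> lcs_len ((x[j := a])[j := x ! j]) y + 1"
    by (rule lcs_len_list_update)
  ultimately show ?thesis by (simp add: abs_le_iff)
qed

section \<open>Superadditive sequences and binomial estimates\<close>

text \<open>Fekete's argument with \<open>L\<close> the supremum of the quotients: \<open>n\<close>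
  is cut into \<open>q\<close> pieces of length \<open>N\<close> and a remainder. Terms may be
  negative, so the remainder is controlled by the uniform lower bound \<open>- D\<close>.\<close>

lemma fekete_superadditive:
  fixes b :: "nat \<Rightarrow> real"
  assumes super: "\<And>m n. b m + b n \<le> b (m + n)"
    and upper: "\<And>n. b n \<le> C * real n" and lower: "\<And>n. - D \<le> b n"
  obtains L where "(\<lambda>n. b n / real n) \<longlonglongrightarrow> L" "\<And>n. b n \<le> L * real n"
proof
  define L where "L = (SUP n\<in>{1..}. b n / real n)"
  have bdd: "bdd_above ((\<lambda>n. b n / real n) ` {1..})"
    using upper by (intro bdd_aboveI[of _ C]) (auto simp: divide_le_eq)
  have le: "b n / real n \<le> L" if "n \<ge> 1" for n
    unfolding L_def using that by (intro cSUP_upper bdd) auto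
  show "b n \<le> L * real n" for n
  proof (cases "n = 0")
    case True
    then show ?thesis using upper[of 0] by simp
  next
    case False
    then show ?thesis using le[of n] by (simp add: divide_le_eq)
  qed
  have mult: "real q * b N + b s \<le> b (q * N + s)" for q N s
  proof (induction q)
    case (Suc q)
    then show ?case using super[of N "q * N + s"] by (simp add: algebra_simps)
  qed simp
  show "(\<lambda>n. b n / real n) \<longlonglongrightarrow> L"
  proof (rule LIMSEQ_I)
    fix r :: real assume r: "0 < r"
    have "\<exists>N\<in>{1..}. L - r / 2 < b N / real N"
      unfolding L_def using r bdd by (subst less_cSUP_iff[symmetric]) auto
    then obtain N where N: "N \<ge> 1" "L - r / 2 < b N / real N" by auto
    have lim: "(\<lambda>n. (\<bar>b N\<bar> + D) / real n) \<longlonglongrightarrow> 0"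
      by (intro tendsto_divide_0[OF tendsto_const] filterlim_at_top_imp_at_infinity
          filterlim_real_sequentially)
    have "\<forall>\<^sub>F n in sequentially. (\<bar>b N\<bar> + D) / real n < r / 2"
      using order_tendstoD(2)[OF lim half_gt_zero[OF r]] .
    then obtain n0 where n0: "\<And>n. n \<ge> n0 \<Longrightarrow> (\<bar>b N\<bar> + D) / real n < r / 2"
      by (auto simp: eventually_sequentially)
    show "\<exists>no. \<forall>n\<ge>no. norm (b n / real n - L) < r"
    proof (intro exI allI impI)
      fix n assume n: "n \<ge> max 1 n0"
      define q s where "q = n div N" and "s = n mod N"
      have ns: "n = q * N + s" and sN: "s < N" using N by (simp_all add: q_def s_def)
      \<comment> \<open>The incomplete piece costs at most \<open>\<bar>b N\<bar>\<close>, whatever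
        the sign of \<open>t\<close>.\<close>
      define t where "t = b N / real N"
      have bN: "b N = t * real N" using N by (simp add: t_def)
      have "real s * t \<le> real s * \<bar>t\<bar>" by (intro mult_left_mono) auto
      also have "\<dots> \<le> real N * \<bar>t\<bar>" using sN by (intro mult_right_mono) auto
      finally have st: "real s * t \<le> \<bar>b N\<bar>" by (simp add: bN abs_mult mult.commute)
      have "t * real n - \<bar>b N\<bar> - D \<le> real q * b N + b s"
        using st lower[of s] by (simp add: bN ns algebra_simps)
      also have "\<dots> \<le> b n" unfolding ns by (rule mult)
      finally have "t * real n - \<bar>b N\<bar> - D \<le> b n" .
      then have "(t * real n - (\<bar>b N\<bar> + D)) / real n \<le> b n / real n"
        by (intro divide_right_mono) auto
      then have "t - (\<bar>b N\<bar> + D) / real n \<le> b n / real n" using n by (simp add: diff_divide_distrib)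
      moreover have "(\<bar>b N\<bar> + D) / real n < r / 2" using n n0 by simp
      ultimately have "L - r < b n / real n" using N(2) unfolding t_def by linarith
      moreover have "b n / real n \<le> L" using le n by simp
      ultimately show "norm (b n / real n - L) < r" using r by (simp add: abs_less_iff)
    qed
  qed
qed

text \<open>After division by \<open>fact m\<close>, the left side is a single term of the
  exponential series at \<open>m\<close>.\<close>

lemma power_self_le_fact_exp: "real m ^ m \<le> fact m * exp (real m)"
proof -
  have "real m ^ m /\<^sub>R fact m \<le> exp (real m)"
    unfolding exp_def using summable_exp_generic[of "real m"]
    by (intro order.trans[OF _ sum_le_suminf[of _ "{m}"]]) auto
  then show ?thesis by (simp add: field_simps)
qed

lemma binomial_mult_le_exp:
  assumes "m \<ge> 1"
  shows "real ((k * m) choose m) \<le> (exp 1 * real k) ^ m"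
proof -
  have "real ((k * m) choose m) * fact m \<le> real (k * m) ^ m"
    using binomial_fact_pow[of "k * m" m] by (metis of_nat_fact of_nat_le_iff of_nat_mult of_nat_power)
  also have "\<dots> = real k ^ m * real m ^ m" by (simp add: power_mult_distrib)
  also have "\<dots> \<le> real k ^ m * (fact m * exp (real m))"
    by (intro mult_left_mono power_self_le_fact_exp) auto
  also have "exp (real m) = exp 1 ^ m" by (simp add: exp_of_nat_mult[symmetric])
  finally have "real ((k * m) choose m) * fact m \<le> (exp 1 * real k) ^ m * fact m"
    by (simp add: power_mult_distrib mult_ac)
  then show ?thesis by simp
qed

lemma exp_H_e:
  assumes "0 < a" "a < 1"
  shows "exp (H_e a * real m) = a powr (- a * real m) * (1 - a) powr (- (1 - a) * real m)"
  using assms by (simp add: H_e_def powr_def exp_add[symmetric] algebra_simps)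

text \<open>Exponential tilting: with the odds \<open>s = a / (1 - a)\<close>, one term of the
  binomial expansion of \<open>(s + 1) ^ m\<close> is at most the whole. The leftover factor
  \<open>(q / s) ^ j\<close> has base at most 1 because \<open>q \<le> a \<le> s\<close>, so
  \<open>j\<close> may be lowered to \<open>a * m\<close>.\<close>

lemma binomial_power_le_entropy:
  assumes a: "0 < a" "a < 1" and q: "0 < q" "q \<le> a" and j: "a * real m \<le> real j"
  shows "real (m choose j) * q ^ j \<le> exp (H_e a * real m) * q powr (a * real m)"
proof (cases "j \<le> m")
  case False
  then show ?thesis by (simp add: binomial_eq_0)
next
  case jm: True
  define s where "s = a / (1 - a)"
  have s: "s > 0" using a by (simp add: s_def)
  have "real (m choose j) * s ^ j \<le> (\<Sum>i\<le>m. real (m choose i) * s ^ i)"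
    using jm s by (intro member_le_sum) auto
  also have "\<dots> = (s + 1) ^ m" by (subst binomial_ring) simp
  also have "s + 1 = 1 / (1 - a)" using a by (simp add: s_def field_simps)
  finally have bound: "real (m choose j) * s ^ j \<le> (1 / (1 - a)) ^ m" .
  have qs: "q / s \<le> 1" "0 < q / s"
  proof -
    have "a \<le> s" using a by (simp add: s_def field_simps)
    then show "q / s \<le> 1" using q s by (simp add: divide_le_eq)
    show "0 < q / s" using q s by simp
  qed
  have "real (m choose j) * q ^ j = (real (m choose j) * s ^ j) * (q / s) ^ j"
    using s by (simp add: power_divide)
  also have "\<dots> \<le> (1 / (1 - a)) ^ m * (q / s) ^ j"
    using qs by (intro mult_right_mono bound) auto
  also have "(q / s) ^ j = (q / s) powr real j" using qs by (simp add: powr_realpow)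
  also have "\<dots> \<le> (q / s) powr (a * real m)"
    using qs j by (intro powr_mono') auto
  also have "(1 / (1 - a)) ^ m * (q / s) powr (a * real m) =
     exp (H_e a * real m) * q powr (a * real m)"
  proof -
    have "(1 / (1 - a)) ^ m = (1 - a) powr (- real m)"
      using a by (simp add: powr_minus powr_realpow power_inverse divide_inverse)
    moreover have "(q / s) powr (a * real m) =
      q powr (a * real m) * a powr (- a * real m) * (1 - a) powr (a * real m)"
    proof -
      have "q / s = q * (1 - a) / a" using a by (simp add: s_def)
      also have "\<dots> powr (a * real m) = q powr (a * real m) * (1 - a) powr (a * real m) / a powr (a * real m)"
        using a q by (subst powr_divide, simp, simp, subst powr_mult) auto
      finally show ?thesis by (simp add: powr_minus divide_inverse mult_ac)
    qed
    moreover have "(1 - a) powr (- real m) * (1 - a) powr (a * real m) = (1 - a) powr (- (1 - a) * real m)"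
      by (simp add: powr_add[symmetric] algebra_simps)
    ultimately show ?thesis using exp_H_e[OF a, of m] by (simp add: mult_ac)
  qed
  finally show ?thesis using a by (simp add: mult_left_mono)
qed

section \<open>McDiarmid's inequality\<close>

text \<open>Over a finite alphabet every expectation below is a finite sum, which settles all
  integrability questions.\<close>

lemma finite_set_replicate_pmf [simp]: "finite (set_pmf (replicate_pmf n (p :: 'a::finite pmf)))"
proof (rule finite_subset)
  show "set_pmf (replicate_pmf n p) \<subseteq> {xs. set xs \<subseteq> UNIV \<and> length xs = n}"
    by (auto simp: set_replicate_pmf)
qed (rule finite_lists_length_eq, simp)

lemma length_replicate_pmf: "xs \<in> set_pmf (replicate_pmf n p) \<Longrightarrow> length xs = n"
  by (simp add: set_replicate_pmf)

lemma expectation_pair_pmf_finite: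
  fixes f :: "'a \<times> 'b \<Rightarrow> real"
  assumes "finite (set_pmf A)" "finite (set_pmf B)"
  shows "measure_pmf.expectation (pair_pmf A B) f =
    measure_pmf.expectation A (\<lambda>x. measure_pmf.expectation B (\<lambda>y. f (x, y)))"
proof -
  have "measure_pmf.expectation (pair_pmf A B) f =
      (\<Sum>x\<in>set_pmf A. pmf A x *\<^sub>R measure_pmf.expectation (map_pmf (\<lambda>y. (x, y)) B) f)"
    unfolding pair_pmf_def map_pmf_def[symmetric] using assms
    by (intro pmf_expectation_bind) auto
  also have "\<dots> = measure_pmf.expectation A (\<lambda>x. measure_pmf.expectation B (\<lambda>y. f (x, y)))"
    using assms by (subst integral_measure_pmf[of "set_pmf A"]) auto
  finally show ?thesis .
qed

lemma replicate_pmf_Suc_conv_pair: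
  "replicate_pmf (Suc n) p = map_pmf (\<lambda>(x, xs). x # xs) (pair_pmf p (replicate_pmf n p))"
  by (simp add: pair_pmf_def map_pmf_def bind_assoc_pmf bind_return_pmf)

lemma replicate_pmf_add_conv_pair:
  "replicate_pmf (m + n) p = map_pmf (\<lambda>(x, y). x @ y) (pair_pmf (replicate_pmf m p) (replicate_pmf n p))"
  by (simp add: replicate_pmf_distrib pair_pmf_def map_pmf_def bind_assoc_pmf bind_return_pmf)

text \<open>Regrouping independent letters by blocks instead of by sequences. Superadditivity of the
  means and the independence of consecutive blocks both rest on it.\<close>

lemma pair_replicate_pmf_add:
  "pair_pmf (replicate_pmf (a + c) p) (replicate_pmf (b + d) p) =
    map_pmf (\<lambda>((x, y), (x', y')). (x @ x', y @ y'))
      (pair_pmf (pair_pmf (replicate_pmf a p) (replicate_pmf b p))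
        (pair_pmf (replicate_pmf c p) (replicate_pmf d p)))"
  unfolding pair_pmf_def map_pmf_def replicate_pmf_distrib
  by (simp add: bind_assoc_pmf bind_return_pmf)
     (intro bind_pmf_cong refl bind_commute_pmf)

text \<open>Only the oscillation of \<open>g\<close> is known, so the interval for Hoeffding's lemma
  starts at the minimum of \<open>g\<close> over the support.\<close>

lemma Hoeffdings_lemma_pmf:
  fixes A :: "'a pmf" and g :: "'a \<Rightarrow> real"
  assumes fin: "finite (set_pmf A)" and s: "s > 0"
    and osc: "\<And>x y. x \<in> set_pmf A \<Longrightarrow> y \<in> set_pmf A \<Longrightarrow> g x - g y \<le> c"
  shows "measure_pmf.expectation A (\<lambda>x. exp (s * g x)) \<le>
    exp (s * measure_pmf.expectation A g + s\<^sup>2 * c\<^sup>2 / 8)"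
proof -
  define a where "a = Min (g ` set_pmf A)"
  let ?\<mu> = "measure_pmf.expectation A g"
  have "a \<in> g ` set_pmf A" unfolding a_def using fin by (intro Min_in) (auto simp: set_pmf_not_empty)
  then have up: "g x \<le> a + c" if "x \<in> set_pmf A" for x using osc[OF that] by force
  have lo: "a \<le> g x" if "x \<in> set_pmf A" for x unfolding a_def using that fin by simp
  interpret interval_bounded_random_variable "measure_pmf A" g a "a + c"
    by unfold_locales (auto simp: AE_measure_pmf_iff up lo)
  have "(\<integral>\<^sup>+x. exp (s * (g x - ?\<mu>)) \<partial>A) \<le> ennreal (exp (s\<^sup>2 * c\<^sup>2 / 8))"
    using Hoeffdings_lemma_nn_integral[OF s] by simp
  then have "measure_pmf.expectation A (\<lambda>x. exp (s * (g x - ?\<mu>))) \<le> exp (s\<^sup>2 * c\<^sup>2 / 8)"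
    using fin by (subst (asm) nn_integral_eq_integral) (auto intro: integrable_measure_pmf_finite)
  moreover have "measure_pmf.expectation A (\<lambda>x. exp (s * g x)) =
     exp (s * ?\<mu>) * measure_pmf.expectation A (\<lambda>x. exp (s * (g x - ?\<mu>)))"
    by (subst integral_mult_right_zero[symmetric]) (simp add: exp_add[symmetric] algebra_simps)
  ultimately show ?thesis by (simp add: exp_add)
qed

text \<open>Induction by revealing the first letter. Given that letter, the induction hypothesis
  bounds the inner expectation in terms of the conditional mean \<open>g\<close>; \<open>g\<close>
  itself oscillates by at most \<open>c\<close>, so Hoeffding's lemma supplies one more
  factor.\<close>

lemma bounded_differences_mgf:
  fixes p :: "'a::finite pmf" and f :: "'a list \<Rightarrow> real"
  assumes s: "s > 0"
    and diff: "\<And>xs j a. length xs = n \<Longrightarrow> j < n \<Longrightarrow> \<bar>f (xs[j := a]) - f xs\<bar> \<le> c"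
  shows "measure_pmf.expectation (replicate_pmf n p) (\<lambda>xs. exp (s * f xs)) \<le>
    exp (s * measure_pmf.expectation (replicate_pmf n p) f + s\<^sup>2 * real n * c\<^sup>2 / 8)"
  using diff
proof (induction n arbitrary: f)
  case 0
  show ?case by simp
next
  case (Suc n)
  let ?E = "measure_pmf.expectation (replicate_pmf n p)"
  define g where "g x = ?E (\<lambda>xs. f (x # xs))" for x
  have exp_Suc: "measure_pmf.expectation (replicate_pmf (Suc n) p) h =
      measure_pmf.expectation p (\<lambda>x. ?E (\<lambda>xs. h (x # xs)))" for h :: "'a list \<Rightarrow> real"
    unfolding replicate_pmf_Suc_conv_pair
    by (simp add: expectation_pair_pmf_finite case_prod_unfold)
  have osc: "g x - g y \<le> c" for x y
  proof -
    have "g x - g y = ?E (\<lambda>xs. f (x # xs) - f (y # xs))"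
      unfolding g_def by (subst Bochner_Integration.integral_diff) (auto intro: integrable_measure_pmf_finite)
    \<comment> \<open>The tails agree, so the integrand is the effect of changing the first letter
      alone.\<close>
    also have "\<dots> \<le> ?E (\<lambda>_. c)"
    proof (intro integral_mono_AE integrable_measure_pmf_finite)
      show "AE xs in replicate_pmf n p. f (x # xs) - f (y # xs) \<le> c"
        using Suc.prems[of "y # _" 0 x] by (auto simp: AE_measure_pmf_iff set_replicate_pmf abs_le_iff)
    qed auto
    finally show ?thesis by simp
  qed
  have "measure_pmf.expectation (replicate_pmf (Suc n) p) (\<lambda>xs. exp (s * f xs)) =
     measure_pmf.expectation p (\<lambda>x. ?E (\<lambda>xs. exp (s * f (x # xs))))" by (rule exp_Suc)
  also have "\<dots> \<le> measure_pmf.expectation p (\<lambda>x. exp (s * g x + s\<^sup>2 * real n * c\<^sup>2 / 8))"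
  proof (intro integral_mono integrable_measure_pmf_finite)
    fix x
    have "\<bar>f (x # xs[j := a]) - f (x # xs)\<bar> \<le> c" if "length xs = n" "j < n" for xs j a
      using Suc.prems[of "x # xs" "Suc j" a] that by simp
    then show "?E (\<lambda>xs. exp (s * f (x # xs))) \<le> exp (s * g x + s\<^sup>2 * real n * c\<^sup>2 / 8)"
      unfolding g_def by (intro Suc.IH)
  qed auto
  also have "\<dots> = exp (s\<^sup>2 * real n * c\<^sup>2 / 8) * measure_pmf.expectation p (\<lambda>x. exp (s * g x))"
    by (simp add: exp_add mult.commute)
  also have "\<dots> \<le> exp (s\<^sup>2 * real n * c\<^sup>2 / 8) * exp (s * measure_pmf.expectation p g + s\<^sup>2 * c\<^sup>2 / 8)"
    by (intro mult_left_mono Hoeffdings_lemma_pmf s osc) auto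
  also have "\<dots> = exp (s * measure_pmf.expectation (replicate_pmf (Suc n) p) f + s\<^sup>2 * real (Suc n) * c\<^sup>2 / 8)"
    unfolding exp_Suc g_def by (simp add: exp_add[symmetric] field_simps)
  finally show ?case .
qed

lemma mcdiarmid:
  fixes p :: "'a::finite pmf" and f :: "'a list \<Rightarrow> real"
  assumes n: "n > 0" and c: "c > 0" and t: "t > 0"
    and diff: "\<And>xs j a. length xs = n \<Longrightarrow> j < n \<Longrightarrow> \<bar>f (xs[j := a]) - f xs\<bar> \<le> c"
  shows "measure_pmf.prob (replicate_pmf n p)
      {xs. f xs \<ge> measure_pmf.expectation (replicate_pmf n p) f + t} \<le> exp (- (2 * t\<^sup>2) / (real n * c\<^sup>2))"
proof -
  let ?\<mu> = "measure_pmf.expectation (replicate_pmf n p) f"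
  \<comment> \<open>This value minimises the exponent
    \<open>s\<^sup>2 * n * c\<^sup>2 / 8 - s * t\<close> of the Chernoff bound.\<close>
  define s where "s = 4 * t / (real n * c\<^sup>2)"
  have s: "s > 0" using n c t by (simp add: s_def)
  have "measure_pmf.prob (replicate_pmf n p) {xs. f xs \<ge> ?\<mu> + t} \<le>
     measure_pmf.prob (replicate_pmf n p) {xs\<in>space (replicate_pmf n p). exp (s * f xs) \<ge> exp (s * (?\<mu> + t))}"
    using s by (intro measure_pmf.finite_measure_mono) auto
  also have "\<dots> \<le> measure_pmf.expectation (replicate_pmf n p) (\<lambda>xs. exp (s * f xs)) / exp (s * (?\<mu> + t))"
    by (intro integral_Markov_inequality_measure[where A = "{}"] integrable_measure_pmf_finite) auto
  also have "\<dots> \<le> exp (s * ?\<mu> + s\<^sup>2 * real n * c\<^sup>2 / 8) / exp (s * (?\<mu> + t))"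
    by (intro divide_right_mono bounded_differences_mgf s diff) auto
  also have "\<dots> = exp (s\<^sup>2 * real n * c\<^sup>2 / 8 - s * t)"
    by (simp add: exp_diff[symmetric] algebra_simps)
  also have "s\<^sup>2 * real n * c\<^sup>2 / 8 - s * t = - (2 * t\<^sup>2) / (real n * c\<^sup>2)"
    using n c by (simp add: s_def field_simps power2_eq_square)
  finally show ?thesis .
qed

text \<open>The two strings are concatenated to one of \<open>2 * n\<close> independent letters; the
  doubled length cancels the 2 in McDiarmid's exponent.\<close>

lemma mcdiarmid_pair:
  fixes p :: "'a::finite pmf" and F :: "'a list \<Rightarrow> 'a list \<Rightarrow> real"
  assumes n: "n > 0" and c: "c > 0" and t: "t > 0"
    and diff1: "\<And>x y j a. length x = n \<Longrightarrow> length y = n \<Longrightarrow> j < n \<Longrightarrow> \<bar>F (x[j := a]) y - F x y\<bar> \<le> c"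
    and diff2: "\<And>x y j a. length x = n \<Longrightarrow> length y = n \<Longrightarrow> j < n \<Longrightarrow> \<bar>F x (y[j := a]) - F x y\<bar> \<le> c"
  shows "measure_pmf.prob (pair_pmf (replicate_pmf n p) (replicate_pmf n p))
      {(x, y). F x y \<ge> measure_pmf.expectation (pair_pmf (replicate_pmf n p) (replicate_pmf n p)) (\<lambda>(x, y). F x y) + t}
    \<le> exp (- t\<^sup>2 / (real n * c\<^sup>2))"
proof -
  define f where "f z = F (take n z) (drop n z)" for z
  let ?R = "replicate_pmf n p" and ?\<mu> = "measure_pmf.expectation (pair_pmf (replicate_pmf n p) (replicate_pmf n p)) (\<lambda>(x, y). F x y)"
  have f: "f (x @ y) = F x y" if "x \<in> set_pmf ?R" for x y
    using length_replicate_pmf[OF that] by (simp add: f_def)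
  have mean: "measure_pmf.expectation (replicate_pmf (n + n) p) f = ?\<mu>"
    unfolding replicate_pmf_add_conv_pair integral_map_pmf
    by (intro integral_cong_AE) (auto simp: AE_measure_pmf_iff f)
  have "measure_pmf.prob (pair_pmf ?R ?R) {(x, y). F x y \<ge> ?\<mu> + t} =
      measure_pmf.prob (replicate_pmf (n + n) p) {z. f z \<ge> ?\<mu> + t}"
    unfolding replicate_pmf_add_conv_pair measure_map_pmf
    by (intro measure_pmf.finite_measure_eq_AE) (auto simp: AE_measure_pmf_iff f)
  also have "\<dots> \<le> exp (- (2 * t\<^sup>2) / (real (n + n) * c\<^sup>2))"
    unfolding mean[symmetric]
  proof (intro mcdiarmid)
    fix z :: "'a list" and j a assume z: "length z = n + n" "j < n + n"
    show "\<bar>f (z[j := a]) - f z\<bar> \<le> c"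
    proof (cases "j < n")
      case True
      then show ?thesis using z diff1[of "take n z" "drop n z" j a]
        by (simp add: f_def take_update_swap)
    next
      case False
      then have "j - n < n" "drop n (z[j := a]) = (drop n z)[j - n := a]" "take n (z[j := a]) = take n z"
        using z by (auto simp: drop_update_swap)
      then show ?thesis using z diff2[of "take n z" "drop n z" "j - n" a] by (simp add: f_def)
    qed
  qed (use n c t in auto)
  also have "\<dots> = exp (- t\<^sup>2 / (real n * c\<^sup>2))" using n c by (simp add: field_simps)
  finally show ?thesis .
qed

section \<open>The mean score of random strings\<close>

definition mean_lcs :: "'a::finite pmf \<Rightarrow> nat \<Rightarrow> nat \<Rightarrow> real" where
  "mean_lcs p k l = measure_pmf.expectation (pair_pmf (replicate_pmf k p) (replicate_pmf l p))
     (\<lambda>(x, y). real (lcs_len x y))"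

lemma mean_lcs_nonneg: "0 \<le> mean_lcs p k l"
  unfolding mean_lcs_def by (intro integral_nonneg_AE) (auto simp: case_prod_unfold)

lemma mean_lcs_le: "mean_lcs p k l \<le> real k"
proof -
  have "mean_lcs p k l \<le> measure_pmf.expectation (pair_pmf (replicate_pmf k p) (replicate_pmf l p)) (\<lambda>_. real k)"
    unfolding mean_lcs_def
    by (intro integral_mono_AE integrable_measure_pmf_finite)
       (auto simp: AE_measure_pmf_iff dest!: length_replicate_pmf intro: lcs_len_le_length)
  then show ?thesis by simp
qed

lemma mean_lcs_commute: "mean_lcs p k l = mean_lcs p l k"
  unfolding mean_lcs_def
  by (subst pair_commute_pmf) (simp add: case_prod_unfold lcs_len_commute)

lemma mean_lcs_superadditive: "mean_lcs p k l + mean_lcs p k' l' \<le> mean_lcs p (k + k') (l + l')"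
proof -
  let ?A = "pair_pmf (replicate_pmf k p) (replicate_pmf l p)"
  let ?B = "pair_pmf (replicate_pmf k' p) (replicate_pmf l' p)"
  have fin: "finite (set_pmf (pair_pmf ?A ?B))" by simp
  let ?f = "\<lambda>(x, y). real (lcs_len x y)"
  have "mean_lcs p k l + mean_lcs p k' l' =
      measure_pmf.expectation (pair_pmf ?A ?B) (\<lambda>z. ?f (fst z) + ?f (snd z))"
    unfolding mean_lcs_def
    using expectation_pair_pmf_fst[of ?A ?B ?f] expectation_pair_pmf_snd[of ?A ?B ?f]
    by (subst Bochner_Integration.integral_add) (auto intro!: integrable_measure_pmf_finite)
  also have "\<dots> \<le> measure_pmf.expectation (pair_pmf ?A ?B)
      (\<lambda>((x, y), (x', y')). real (lcs_len (x @ x') (y @ y')))"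
    using lcs_len_append
    by (intro integral_mono integrable_measure_pmf_finite)
       (auto simp flip: of_nat_add)
  also have "\<dots> = mean_lcs p (k + k') (l + l')"
    unfolding mean_lcs_def pair_replicate_pmf_add integral_map_pmf
    by (simp add: case_prod_unfold)
  finally show ?thesis .
qed

lemma mean_lcs_mono_right: "l \<le> l' \<Longrightarrow> mean_lcs p k l \<le> mean_lcs p k l'"
  using mean_lcs_superadditive[of p k l 0 "l' - l"] mean_lcs_nonneg[of p 0 "l' - l"] by simp

lemma mean_lcs_add_right: "mean_lcs p k (l + d) \<le> mean_lcs p k l + real d"
proof -
  let ?K = "replicate_pmf k p" and ?L = "replicate_pmf l p" and ?D = "replicate_pmf d p"
  have marginal: "measure_pmf.expectation (pair_pmf ?L ?D) (\<lambda>z. real (lcs_len x (fst z))) =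
      measure_pmf.expectation ?L (\<lambda>y. real (lcs_len x y))" for x
    by (rule expectation_pair_pmf_fst)
  have "mean_lcs p k (l + d) = measure_pmf.expectation ?K (\<lambda>x. measure_pmf.expectation (pair_pmf ?L ?D)
      (\<lambda>(y, y'). real (lcs_len x (y @ y'))))"
    unfolding mean_lcs_def
    by (subst expectation_pair_pmf_finite) (auto simp: replicate_pmf_add_conv_pair case_prod_unfold)
  also have "\<dots> \<le> measure_pmf.expectation ?K (\<lambda>x. measure_pmf.expectation (pair_pmf ?L ?D)
      (\<lambda>z. real (lcs_len x (fst z)) + real d))"
    using lcs_len_append_right
    by (intro integral_mono integrable_measure_pmf_finite integral_mono_AE)
       (auto simp: AE_measure_pmf_iff simp flip: of_nat_add dest!: length_replicate_pmf)
  also have "\<dots> = measure_pmf.expectation ?K (\<lambda>x. measure_pmf.expectation ?L (\<lambda>y. real (lcs_len x y)) + real d)"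
    by (subst Bochner_Integration.integral_add) (auto intro!: integrable_measure_pmf_finite simp: marginal)
  also have "\<dots> = mean_lcs p k l + real d"
    unfolding mean_lcs_def expectation_pair_pmf_finite[OF finite_set_replicate_pmf finite_set_replicate_pmf]
    by (subst Bochner_Integration.integral_add) (auto intro!: integrable_measure_pmf_finite)
  finally show ?thesis .
qed

text \<open>The real slack \<open>d\<close> is what ceilings and floors of lengths produce in the
  limit arguments below.\<close>

lemma mean_lcs_le_add:
  assumes "real l \<le> real l' + d" "0 \<le> d"
  shows "mean_lcs p k l \<le> mean_lcs p k l' + d"
proof (cases "l \<le> l'")
  case True
  then show ?thesis using mean_lcs_mono_right[of l l' p k] assms by simp
next
  case False
  then show ?thesis using mean_lcs_add_right[of p k l' "l - l'"] assms by simp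
qed

lemma mean_lcs_mult: "real a * mean_lcs p k l \<le> mean_lcs p (a * k) (a * l)"
proof (induction a)
  case (Suc a)
  then show ?case using mean_lcs_superadditive[of p "a * k" "a * l" k l]
    by (simp add: algebra_simps)
qed (simp add: mean_lcs_nonneg)

text \<open>Rounding up destroys superadditivity of the sequence by at most one unit, whence the
  correction term \<open>1\<close>.\<close>

lemma mean_lcs_limit:
  assumes q: "0 < q"
  obtains g where
    "(\<lambda>n. mean_lcs p n (nat \<lceil>real n * q\<rceil>) / (real n * (1 + q) / 2)) \<longlonglongrightarrow> g"
    "\<And>n. mean_lcs p n (nat \<lceil>real n * q\<rceil>) \<le> g * (real n * (1 + q) / 2) + 1"
    "0 \<le> g"
proof -
  define b where "b n = mean_lcs p n (nat \<lceil>real n * q\<rceil>) - 1" for n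
  have ceil: "real (nat \<lceil>u\<rceil> + nat \<lceil>v\<rceil>) \<le> real (nat \<lceil>u + v\<rceil>) + 1" if "0 \<le> u" "0 \<le> v" for u v :: real
  proof -
    have "\<lceil>u\<rceil> + \<lceil>v\<rceil> \<le> \<lceil>u + v\<rceil> + 1" by linarith
    then have "nat \<lceil>u\<rceil> + nat \<lceil>v\<rceil> \<le> nat \<lceil>u + v\<rceil> + 1" using that by linarith
    then show ?thesis by linarith
  qed
  have "b m + b n \<le> b (m + n)" for m n
  proof -
    have "mean_lcs p m (nat \<lceil>real m * q\<rceil>) + mean_lcs p n (nat \<lceil>real n * q\<rceil>) \<le>
        mean_lcs p (m + n) (nat \<lceil>real m * q\<rceil> + nat \<lceil>real n * q\<rceil>)"
      by (rule mean_lcs_superadditive)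
    also have "\<dots> \<le> mean_lcs p (m + n) (nat \<lceil>real (m + n) * q\<rceil>) + 1"
    proof (intro mean_lcs_le_add)
      show "real (nat \<lceil>real m * q\<rceil> + nat \<lceil>real n * q\<rceil>) \<le> real (nat \<lceil>real (m + n) * q\<rceil>) + 1"
        using ceil[of "real m * q" "real n * q"] q by (simp add: distrib_right)
    qed simp
    finally show ?thesis by (simp add: b_def)
  qed
  moreover have "b n \<le> 1 * real n" for n
    using mean_lcs_le[of p n] unfolding b_def by (smt (verit, best))
  moreover have "- 1 \<le> b n" for n by (simp add: b_def mean_lcs_nonneg)
  ultimately obtain L where L: "(\<lambda>n. b n / real n) \<longlonglongrightarrow> L" "\<And>n. b n \<le> L * real n"
    by (rule fekete_superadditive[of b 1 1]) blast
  define g where "g = L / ((1 + q) / 2)"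
  have "(\<lambda>n. (b n / real n + 1 / real n) / ((1 + q) / 2)) \<longlonglongrightarrow> (L + 0) / ((1 + q) / 2)"
    using q by (intro tendsto_intros L lim_1_over_n) auto
  then have lim: "(\<lambda>n. mean_lcs p n (nat \<lceil>real n * q\<rceil>) / (real n * (1 + q) / 2)) \<longlonglongrightarrow> g"
    by (simp add: g_def b_def diff_divide_distrib)
  show thesis
  proof (rule that[OF lim])
    show "mean_lcs p n (nat \<lceil>real n * q\<rceil>) \<le> g * (real n * (1 + q) / 2) + 1" for n
      using L(2)[of n] q by (simp add: g_def b_def)
    show "0 \<le> g"
      using q by (intro tendsto_lowerbound[OF lim] always_eventually allI divide_nonneg_nonneg mean_lcs_nonneg) auto
  qed
qed

text \<open>Concavity of the rate in disguise: aligning \<open>\<alpha>T\<close> strings of shape \<open>(k1, l1)\<close> and then \<open>\<beta>T\<close>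
  strings of shape \<open>(k2, l2)\<close>, with \<open>T \<rightarrow> \<infinity>\<close>, yields a pair of strings of slope \<open>q\<close>.\<close>

lemma mean_lcs_combination:
  assumes q: "0 < q" and g: "0 \<le> g"
    and bound: "\<And>n. mean_lcs p n (nat \<lceil>real n * q\<rceil>) \<le> g * (real n * (1 + q) / 2) + 1"
    and nonneg: "0 \<le> \<alpha>" "0 \<le> \<beta>"
    and slope: "\<alpha> * real l1 + \<beta> * real l2 = q * (\<alpha> * real k1 + \<beta> * real k2)"
  shows "\<alpha> * mean_lcs p k1 l1 + \<beta> * mean_lcs p k2 l2 \<le>
    g * (\<alpha> * real (k1 + l1) + \<beta> * real (k2 + l2)) / 2"
proof (rule ccontr)
  let ?lhs = "\<alpha> * mean_lcs p k1 l1 + \<beta> * mean_lcs p k2 l2"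
  let ?n = "\<alpha> * real k1 + \<beta> * real k2"
  assume "\<not> ?thesis"
  then have pos: "0 < ?lhs - g * (?n * (1 + q) / 2)"
    using slope by (simp add: algebra_simps)
  \<comment> \<open>\<open>C\<close> bounds the excess length in \<open>Y\<close> caused by rounding
    the numbers of strings down; \<open>D\<close> collects all errors, none of which grows with
    \<open>T\<close>.\<close>
  define C where "C = q * real (k1 + k2)"
  define D where "D = C + 1 + mean_lcs p k1 l1 + mean_lcs p k2 l2"
  have C: "0 \<le> C" using q by (simp add: C_def)
  have "real T * (?lhs - g * (?n * (1 + q) / 2)) \<le> D" for T :: nat
  proof -
    define a b where "a = nat \<lfloor>real T * \<alpha>\<rfloor>" and "b = nat \<lfloor>real T * \<beta>\<rfloor>"
    have a: "real a \<le> real T * \<alpha>" "real T * \<alpha> \<le> real a + 1"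
      and b: "real b \<le> real T * \<beta>" "real T * \<beta> \<le> real b + 1"
      using nonneg by (auto simp: a_def b_def)
    define n l where "n = a * k1 + b * k2" and "l = a * l1 + b * l2"
    have n_le: "real n \<le> real T * ?n"
      using mult_right_mono[OF a(1), of "real k1"] mult_right_mono[OF b(1), of "real k2"]
      by (simp add: n_def algebra_simps)
    have n_ge: "real T * ?n \<le> real n + real (k1 + k2)"
      using mult_right_mono[OF a(2), of "real k1"] mult_right_mono[OF b(2), of "real k2"]
      by (simp add: n_def algebra_simps)
    have "real l \<le> real T * (\<alpha> * real l1 + \<beta> * real l2)"
      using mult_right_mono[OF a(1), of "real l1"] mult_right_mono[OF b(1), of "real l2"]
      by (simp add: l_def algebra_simps)
    also have "\<dots> = q * (real T * ?n)" unfolding slope by simp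
    also have "\<dots> \<le> q * (real n + real (k1 + k2))" using q n_ge by (intro mult_left_mono) auto
    also have "\<dots> = real n * q + C" by (simp add: C_def algebra_simps)
    also have "\<dots> \<le> real (nat \<lceil>real n * q\<rceil>) + C" by linarith
    finally have l: "real l \<le> real (nat \<lceil>real n * q\<rceil>) + C" .
    have "real T * ?lhs \<le> (real a + 1) * mean_lcs p k1 l1 + (real b + 1) * mean_lcs p k2 l2"
      using mult_right_mono[OF a(2), of "mean_lcs p k1 l1"] mult_right_mono[OF b(2), of "mean_lcs p k2 l2"]
      by (simp add: mean_lcs_nonneg algebra_simps)
    also have "\<dots> \<le> mean_lcs p n l + mean_lcs p k1 l1 + mean_lcs p k2 l2"
      using mean_lcs_mult[of a p k1 l1] mean_lcs_mult[of b p k2 l2]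
        mean_lcs_superadditive[of p "a * k1" "a * l1" "b * k2" "b * l2"]
      by (simp add: n_def l_def algebra_simps)
    also have "mean_lcs p n l \<le> g * (real n * (1 + q) / 2) + 1 + C"
      using mean_lcs_le_add[OF l C, of p n] bound[of n] by simp
    also have "g * (real n * (1 + q) / 2) \<le> g * ((real T * ?n) * (1 + q) / 2)"
      using n_le q g by (intro mult_left_mono divide_right_mono mult_right_mono) auto
    finally show ?thesis by (simp add: D_def algebra_simps)
  qed
  \<comment> \<open>A positive gap multiplied by \<open>T\<close> cannot stay below the constant
    \<open>D\<close>.\<close>
  moreover obtain T :: nat where "D < real T * (?lhs - g * (?n * (1 + q) / 2))"
    using reals_Archimedean3[OF pos] by blast
  ultimately show False by (meson not_le)
qed

text \<open>A shape further off the diagonal than \<open>q\<close> is mixed with a diagonal shape, whose rate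
  exceeds \<open>g\<close>, so as to reach slope \<open>q\<close>.\<close>

lemma mean_lcs_le_of_slope:
  assumes lim: "(\<lambda>n. mean_lcs p n n / real n) \<longlonglongrightarrow> \<gamma>" and "g < \<gamma>"
    and q: "0 < q" and g: "0 \<le> g"
    and bound: "\<And>n. mean_lcs p n (nat \<lceil>real n * q\<rceil>) \<le> g * (real n * (1 + q) / 2) + 1"
    and side: "(real l < real k * q \<and> q < 1) \<or> (real k * q < real l \<and> 1 < q)"
  shows "mean_lcs p k l \<le> g * real (k + l) / 2"
proof -
  have "\<forall>\<^sub>F n in sequentially. g < mean_lcs p n n / real n" by (rule order_tendstoD(1)[OF lim]) fact
  then have "\<forall>\<^sub>F n in sequentially. g < mean_lcs p n n / real n \<and> 0 < n"
    using eventually_gt_at_top[of 0] by (rule eventually_conj)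
  then obtain N where N: "g < mean_lcs p N N / real N" "0 < N"
    using eventually_happens'[OF sequentially_bot] by blast
  \<comment> \<open>The weights solve \<open>\<alpha> * (q * k - l) = \<beta> * N * (1 - q)\<close>,
    which says that the mixture has slope \<open>q\<close>; by \<open>side\<close> both differences
    have the same sign, so absolute values give nonnegative weights.\<close>
  define \<alpha> \<beta> where "\<alpha> = real N * \<bar>1 - q\<bar>" and "\<beta> = \<bar>real k * q - real l\<bar>"
  have \<alpha>: "0 < \<alpha>" and \<beta>: "0 \<le> \<beta>" using side N by (auto simp: \<alpha>_def \<beta>_def)
  have "\<alpha> * real l + \<beta> * real N = q * (\<alpha> * real k + \<beta> * real N)"
    using side by (auto simp: \<alpha>_def \<beta>_def algebra_simps)
  then have "\<alpha> * mean_lcs p k l + \<beta> * mean_lcs p N N \<le> g * (\<alpha> * real (k + l) + \<beta> * real (N + N)) / 2"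
    using \<alpha> \<beta> by (intro mean_lcs_combination[OF q g bound]) auto
  \<comment> \<open>The diagonal strings already reach rate \<open>g\<close>, so their terms cancel
    and the bound is left for shape \<open>(k, l)\<close> alone.\<close>
  moreover have "g * real N \<le> mean_lcs p N N" using N by (simp add: field_simps)
  then have "\<beta> * (g * real N) \<le> \<beta> * mean_lcs p N N" using \<beta> by (rule mult_left_mono)
  ultimately have "\<alpha> * mean_lcs p k l \<le> \<alpha> * (g * real (k + l) / 2)" by (simp add: algebra_simps)
  then show ?thesis using \<alpha> by (simp only: mult_le_cancel_left_pos)
qed

text \<open>Mixing the shapes \<open>(k, l)\<close> and \<open>(l, k)\<close> in equal parts gives
  slope 1, and by symmetry both have the same mean.\<close>

lemma mean_lcs_le_diagonal:
  assumes g: "0 \<le> g" and bound: "\<And>n. mean_lcs p n n \<le> g * real n + 1"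
  shows "mean_lcs p k l \<le> g * real (k + l) / 2"
proof -
  have "1 * mean_lcs p k l + 1 * mean_lcs p l k \<le> g * (1 * real (k + l) + 1 * real (l + k)) / 2"
    using bound by (intro mean_lcs_combination[of 1 g]) (auto simp: g)
  then show ?thesis using mean_lcs_commute[of p k l] by (simp add: algebra_simps)
qed

section \<open>Subwords of two independent iid sequences\<close>

lemma pmf_replicate_pmf:
  "pmf (replicate_pmf n p) xs = (if length xs = n then prod_list (map (pmf p) xs) else 0)"
proof (cases "length xs = n")
  case True
  then show ?thesis
  proof (induction n arbitrary: xs)
    case (Suc n)
    then obtain x ys where xs: "xs = x # ys" "length ys = n" by (auto simp: length_Suc_conv)
    have "pmf (replicate_pmf (Suc n) p) xs = pmf (pair_pmf p (replicate_pmf n p)) (x, ys)"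
      unfolding replicate_pmf_Suc_conv_pair xs
      using pmf_map_inj'[of "\<lambda>(x, xs). x # xs" "pair_pmf p (replicate_pmf n p)" "(x, ys)"]
      by (simp add: inj_def)
    then show ?case using Suc.IH[OF xs(2)] xs by (simp add: pmf_pair)
  qed simp
qed (auto simp: pmf_eq_0_set_pmf set_replicate_pmf)

text \<open>An event about a word becomes a conjunction over single letters, the form in which
  independence applies. The letter of index \<open>i\<close> is entry \<open>i - a - 1\<close>
  because lists count from 0.\<close>

lemma word_eq_iff:
  "word X a (a + k) \<omega> = x \<longleftrightarrow> length x = k \<and> (\<forall>i\<in>{a + 1..a + k}. X i \<omega> = x ! (i - a - 1))"
proof (cases "length x = k")
  case True
  have "word X a (a + k) \<omega> = x \<longleftrightarrow> (\<forall>i<k. X (a + 1 + i) \<omega> = x ! i)"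
    unfolding word_def using True by (auto simp: list_eq_iff_nth_eq simp del: upt_Suc)
  also have "\<dots> \<longleftrightarrow> (\<forall>i\<in>{a + 1..a + k}. X i \<omega> = x ! (i - a - 1))"
  proof safe
    fix i assume "\<forall>i<k. X (a + 1 + i) \<omega> = x ! i" "i \<in> {a + 1..a + k}"
    then show "X i \<omega> = x ! (i - a - 1)"
      by (auto dest!: spec[of _ "i - a - 1"])
  next
    fix i assume "\<forall>i\<in>{a + 1..a + k}. X i \<omega> = x ! (i - a - 1)" "i < k"
    then show "X (a + 1 + i) \<omega> = x ! i" by (auto dest!: bspec[of _ _ "a + 1 + i"])
  qed
  finally show ?thesis using True by simp
qed (auto simp: word_def)

text \<open>The analogue of \<open>word\<close> for a fixed string. It turns scores into functions
  of two strings, as bounded differences require.\<close>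

definition block :: "'a list \<Rightarrow> nat \<Rightarrow> nat \<Rightarrow> 'a list" where
  "block x a b = take (b - a) (drop a x)"

lemma length_word [simp]: "length (word X a b \<omega>) = b - a"
  by (simp add: word_def del: upt_Suc)

lemma block_word:
  assumes "b \<le> n"
  shows "block (word X 0 n \<omega>) a b = word X a b \<omega>"
  using assms unfolding block_def word_def by (auto simp: drop_map take_map list_eq_iff_nth_eq simp del: upt_Suc)

lemma word_cong:
  "word Z 0 n \<omega> = word Z 0 n \<omega>' \<Longrightarrow> b \<le> n \<Longrightarrow> word Z a b \<omega> = word Z a b \<omega>'"
  by (metis block_word)

lemma word_append: "a \<le> b \<Longrightarrow> word X 0 b \<omega> = word X 0 a \<omega> @ word X a b \<omega>"
  by (auto simp: word_def list_eq_iff_nth_eq nth_append simp del: upt_Suc)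

text \<open>Independence of the joint family over the disjoint sum of index sets covers independence
  within each sequence as well as between the two.\<close>

locale iid_words = prob_space M for M :: "'w measure" +
  fixes X Y :: "nat \<Rightarrow> 'w \<Rightarrow> 'a::finite" and p :: "'a pmf"
  assumes indep: "indep_vars (\<lambda>_. count_space UNIV) (case_sum X Y) ({1..} <+> {1..})"
    and law_X: "i \<ge> 1 \<Longrightarrow> prob {\<omega> \<in> space M. X i \<omega> = a} = pmf p a"
    and law_Y: "i \<ge> 1 \<Longrightarrow> prob {\<omega> \<in> space M. Y i \<omega> = a} = pmf p a"
begin

lemma singleton_words:
  fixes x y :: "'a list" and a b k l :: nat
  defines "E \<equiv> {\<omega> \<in> space M. word X a (a + k) \<omega> = x \<and> word Y b (b + l) \<omega> = y}"
  shows "E \<in> events" "prob E = pmf (replicate_pmf k p) x * pmf (replicate_pmf l p) y"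
proof -
  have "E \<in> events \<and> prob E = pmf (replicate_pmf k p) x * pmf (replicate_pmf l p) y"
  proof (cases "length x = k \<and> length y = l")
    case False
    then have "E = {}" unfolding E_def by auto
    then show ?thesis using False by (auto simp: pmf_replicate_pmf)
  next
    case True
    let ?Z = "case_sum X Y"
    define J where "J = {a + 1..a + k} <+> {b + 1..b + l}"
    define c where "c = case_sum (\<lambda>i. x ! (i - a - 1)) (\<lambda>i. y ! (i - b - 1))"
    define A where "A j = ?Z j -` {c j} \<inter> space M" for j
    have "(\<forall>j\<in>J. ?Z j \<omega> = c j) \<longleftrightarrow> (\<forall>i\<in>{a + 1..a + k}. X i \<omega> = x ! (i - a - 1)) \<and>
        (\<forall>i\<in>{b + 1..b + l}. Y i \<omega> = y ! (i - b - 1))" for \<omega>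
      unfolding J_def c_def Plus_def ball_Un by simp
    then have "E = {\<omega> \<in> space M. \<forall>j\<in>J. ?Z j \<omega> = c j}"
      using True unfolding E_def word_eq_iff by simp
    \<comment> \<open>Intersecting with \<open>space M\<close> covers the case of two empty words,
      where \<open>J\<close> is empty.\<close>
    then have E: "E = space M \<inter> (\<Inter>j\<in>J. A j)" unfolding A_def by auto
    have J: "finite J" "J \<subseteq> {1..} <+> {1..}" by (auto simp: J_def)
    have A: "A j \<in> events" if "j \<in> J" for j
    proof -
      have "?Z j \<in> measurable M (count_space UNIV)"
        using indep J that unfolding indep_vars_def by blast
      then show ?thesis unfolding A_def by (rule measurable_sets) simp
    qed
    have ev: "E \<in> events"
      unfolding E using J A by (cases "J = {}") (auto intro!: sets.Int sets.finite_INT)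
    have "prob E = (\<Prod>j\<in>J. prob (A j))"
    proof (cases "J = {}")
      case True
      then show ?thesis unfolding E by (simp add: prob_space)
    next
      case False
      have "E = (\<Inter>j\<in>J. A j)" using False unfolding E A_def by auto
      then show ?thesis using indep_varsD[OF indep, of J "\<lambda>j. {c j}"] J False
        unfolding A_def by simp
    qed
    also have "\<dots> = (\<Prod>j\<in>J. pmf p (c j))"
    proof (intro prod.cong refl)
      fix j assume "j \<in> J"
      then show "prob (A j) = pmf p (c j)"
        using law_X law_Y unfolding J_def A_def
        by (auto simp: vimage_def Int_def conj_commute)
    qed
    also have "\<dots> = (\<Prod>i\<in>{a + 1..a + k}. pmf p (x ! (i - a - 1))) * (\<Prod>i\<in>{b + 1..b + l}. pmf p (y ! (i - b - 1)))"
      unfolding J_def by (subst prod.Plus) (auto simp: c_def)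
    also have "(\<Prod>i\<in>{a + 1..a + k}. pmf p (x ! (i - a - 1))) = prod_list (map (pmf p) x)"
      unfolding prod.list_conv_set_nth using True
      by (intro prod.reindex_bij_witness[of _ "\<lambda>i. i + a + 1" "\<lambda>i. i - a - 1"]) auto
    also have "(\<Prod>i\<in>{b + 1..b + l}. pmf p (y ! (i - b - 1))) = prod_list (map (pmf p) y)"
      unfolding prod.list_conv_set_nth using True
      by (intro prod.reindex_bij_witness[of _ "\<lambda>i. i + b + 1" "\<lambda>i. i - b - 1"]) auto
    finally show ?thesis using ev True by (simp add: pmf_replicate_pmf)
  qed
  then show "E \<in> events" "prob E = pmf (replicate_pmf k p) x * pmf (replicate_pmf l p) y"
    by auto
qed

text \<open>Pairs of strings over a finite alphabet form a countable set, so preimages of singletons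
  suffice.\<close>

lemma measurable_words [measurable]:
  "(\<lambda>\<omega>. (word X a (a + k) \<omega>, word Y b (b + l) \<omega>)) \<in> measurable M (count_space UNIV)"
proof (subst measurable_count_space_eq2_countable)
  show "(\<lambda>\<omega>. (word X a (a + k) \<omega>, word Y b (b + l) \<omega>)) \<in> space M \<rightarrow> UNIV \<and>
    (\<forall>z\<in>UNIV. (\<lambda>\<omega>. (word X a (a + k) \<omega>, word Y b (b + l) \<omega>)) -` {z} \<inter> space M \<in> events)"
    using singleton_words(1) by (auto simp: vimage_def Int_def conj_commute)
qed

text \<open>The law does not involve the starting points \<open>a\<close> and \<open>b\<close>: this
  is stationarity, and it moves all later computations from \<open>M\<close> to product
  pmfs.\<close>

lemma distr_words:
  "distr M (count_space UNIV) (\<lambda>\<omega>. (word X a (a + k) \<omega>, word Y b (b + l) \<omega>)) =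
    measure_pmf (pair_pmf (replicate_pmf k p) (replicate_pmf l p))"
proof (rule measure_eqI_countable[where A = UNIV])
  fix z :: "'a list \<times> 'a list"
  obtain x y where z: "z = (x, y)" by (cases z)
  have "prob ((\<lambda>\<omega>. (word X a (a + k) \<omega>, word Y b (b + l) \<omega>)) -` {z} \<inter> space M) = pmf (pair_pmf (replicate_pmf k p) (replicate_pmf l p)) z"
    using singleton_words(2)[of a k x b l y] by (simp add: z pmf_pair vimage_def Int_def conj_commute)
  then show "emeasure (distr M (count_space UNIV) (\<lambda>\<omega>. (word X a (a + k) \<omega>, word Y b (b + l) \<omega>))) {z} =
     emeasure (measure_pmf (pair_pmf (replicate_pmf k p) (replicate_pmf l p))) {z}"
    by (simp add: emeasure_distr emeasure_eq_measure emeasure_pmf_single)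
qed auto

lemma prob_words:
  "prob {\<omega> \<in> space M. Q (word X a (a + k) \<omega>) (word Y b (b + l) \<omega>)} =
    measure_pmf.prob (pair_pmf (replicate_pmf k p) (replicate_pmf l p)) {(x, y). Q x y}"
  unfolding distr_words[symmetric, of k l a b]
  by (subst measure_distr) (auto intro!: arg_cong[where f = prob])

lemma expectation_words:
  fixes F :: "'a list \<Rightarrow> 'a list \<Rightarrow> real"
  shows "expectation (\<lambda>\<omega>. F (word X a (a + k) \<omega>) (word Y b (b + l) \<omega>)) =
    measure_pmf.expectation (pair_pmf (replicate_pmf k p) (replicate_pmf l p)) (\<lambda>(x, y). F x y)"
  unfolding distr_words[symmetric, of k l a b]
  by (subst integral_distr) auto

lemma integrable_words:
  fixes F :: "'a list \<Rightarrow> 'a list \<Rightarrow> real"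
  shows "integrable M (\<lambda>\<omega>. F (word X a (a + k) \<omega>) (word Y b (b + l) \<omega>))"
proof -
  have "integrable (distr M (count_space UNIV) (\<lambda>\<omega>. (word X a (a + k) \<omega>, word Y b (b + l) \<omega>))) (\<lambda>(x, y). F x y)"
    unfolding distr_words by (intro integrable_measure_pmf_finite) simp
  then show ?thesis by (subst (asm) integrable_distr_eq) auto
qed

text \<open>A set determined by the first \<open>n\<close> letters is the preimage of its own image
  under the word map. This gives measurability of events that quantify over all optimal
  alignments.\<close>

lemma events_words:
  assumes "S \<subseteq> space M"
    and det: "\<And>\<omega> \<omega>'. \<omega> \<in> S \<Longrightarrow> \<omega>' \<in> space M \<Longrightarrow> word X 0 n \<omega> = word X 0 n \<omega>' \<Longrightarrow>
      word Y 0 n \<omega> = word Y 0 n \<omega>' \<Longrightarrow> \<omega>' \<in> S"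
  shows "S \<in> events"
proof -
  let ?W = "\<lambda>\<omega>. (word X 0 (0 + n) \<omega>, word Y 0 (0 + n) \<omega>)"
  have "S = ?W -` (?W ` S) \<inter> space M" using assms by auto
  also have "\<dots> \<in> events" by (rule measurable_sets[OF measurable_words]) simp
  finally show ?thesis .
qed

text \<open>The two conditions read disjoint sets of letters. Iterated, this yields the independence
  of all blocks of a fixed cut.\<close>

lemma prob_words_indep:
  "prob {\<omega> \<in> space M. Q (word X 0 a \<omega>) (word Y 0 b \<omega>) \<and> R (word X a (a + c) \<omega>) (word Y b (b + d) \<omega>)} =
    prob {\<omega> \<in> space M. Q (word X 0 a \<omega>) (word Y 0 b \<omega>)} *
    prob {\<omega> \<in> space M. R (word X a (a + c) \<omega>) (word Y b (b + d) \<omega>)}"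
proof -
  let ?A = "pair_pmf (replicate_pmf a p) (replicate_pmf b p)"
  let ?B = "pair_pmf (replicate_pmf c p) (replicate_pmf d p)"
  have "prob {\<omega> \<in> space M. Q (word X 0 a \<omega>) (word Y 0 b \<omega>) \<and> R (word X a (a + c) \<omega>) (word Y b (b + d) \<omega>)} =
    prob {\<omega> \<in> space M. (\<lambda>x y. Q (take a x) (take b y) \<and> R (drop a x) (drop b y))
      (word X 0 (0 + (a + c)) \<omega>) (word Y 0 (0 + (b + d)) \<omega>)}"
    by (simp add: word_append[of a "a + c"] word_append[of b "b + d"])
  also have "\<dots> = measure_pmf.prob (pair_pmf ?A ?B) ({(x, y). Q x y} \<times> {(x, y). R x y})"
    unfolding prob_words[of "\<lambda>x y. Q (take a x) (take b y) \<and> R (drop a x) (drop b y)" 0 "a + c" 0 "b + d"]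
      pair_replicate_pmf_add measure_map_pmf
    by (intro measure_pmf.finite_measure_eq_AE) (auto simp: AE_measure_pmf_iff set_replicate_pmf)
  also have "\<dots> = measure_pmf.expectation (pair_pmf ?A ?B)
      (\<lambda>(u, v). indicator {(x, y). Q x y} u * indicator {(x, y). R x y} v)"
  proof -
    have "measure_pmf.prob (pair_pmf ?A ?B) ({(x, y). Q x y} \<times> {(x, y). R x y}) =
        measure_pmf.expectation (pair_pmf ?A ?B) (indicator ({(x, y). Q x y} \<times> {(x, y). R x y}))"
      by simp
    also have "indicator ({(x, y). Q x y} \<times> {(x, y). R x y}) =
        (\<lambda>(u, v). indicator {(x, y). Q x y} u * indicator {(x, y). R x y} v :: real)"
      by (auto simp: indicator_def fun_eq_iff)
    finally show ?thesis .
  qed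
  also have "\<dots> = measure_pmf.prob ?A {(x, y). Q x y} * measure_pmf.prob ?B {(x, y). R x y}"
    by (subst expectation_pair_pmf_finite) auto
  finally show ?thesis using prob_words[of Q 0 a 0 b] prob_words[of R a c b d] by simp
qed

lemma prob_concentration:
  fixes F :: "'a list \<Rightarrow> 'a list \<Rightarrow> real"
  assumes n: "n > 0" and c: "c > 0" and t: "t > 0"
    and diff1: "\<And>x y j a. length x = n \<Longrightarrow> length y = n \<Longrightarrow> j < n \<Longrightarrow> \<bar>F (x[j := a]) y - F x y\<bar> \<le> c"
    and diff2: "\<And>x y j a. length x = n \<Longrightarrow> length y = n \<Longrightarrow> j < n \<Longrightarrow> \<bar>F x (y[j := a]) - F x y\<bar> \<le> c"
    and mean: "expectation (\<lambda>\<omega>. F (word X 0 n \<omega>) (word Y 0 n \<omega>)) \<le> - t"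
  shows "prob {\<omega> \<in> space M. F (word X 0 n \<omega>) (word Y 0 n \<omega>) \<ge> 0} \<le> exp (- t\<^sup>2 / (real n * c\<^sup>2))"
proof -
  let ?P = "pair_pmf (replicate_pmf n p) (replicate_pmf n p)"
  have \<mu>: "measure_pmf.expectation ?P (\<lambda>(x, y). F x y) \<le> - t"
    using mean expectation_words[of F 0 n 0 n] by simp
  have "prob {\<omega> \<in> space M. F (word X 0 n \<omega>) (word Y 0 n \<omega>) \<ge> 0} = measure_pmf.prob ?P {(x, y). F x y \<ge> 0}"
    using prob_words[of "\<lambda>x y. F x y \<ge> 0" 0 n 0 n] by simp
  \<comment> \<open>The mean is at most \<open>- t\<close>, so reaching 0 is an upward deviation of
    at least \<open>t\<close>.\<close>
  also have "\<dots> \<le> measure_pmf.prob ?P {(x, y). F x y \<ge> measure_pmf.expectation ?P (\<lambda>(x, y). F x y) + t}"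
    using \<mu> by (intro measure_pmf.finite_measure_mono) auto
  also have "\<dots> \<le> exp (- t\<^sup>2 / (real n * c\<^sup>2))"
    by (intro mcdiarmid_pair n c t diff1 diff2)
  finally show ?thesis .
qed

end

section \<open>Cut vectors\<close>

text \<open>Fixing the value 0 beyond \<open>m\<close> picks one representative of each integer
  vector, so that counting makes sense.\<close>

definition cut_vectors :: "nat \<Rightarrow> nat \<Rightarrow> (nat \<Rightarrow> nat) set" where
  "cut_vectors n m = {r. cut_vector n m r \<and> (\<forall>i>m. r i = 0)}"

lemma cut_vector_less: "cut_vector n m r \<Longrightarrow> i < j \<Longrightarrow> j \<le> m \<Longrightarrow> r i < r j"
  unfolding cut_vector_def using strict_mono_onD[of "{0..m}" r i j] by auto

lemma cut_vector_mono: "cut_vector n m r \<Longrightarrow> i \<le> j \<Longrightarrow> j \<le> m \<Longrightarrow> r i \<le> r j"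
  using cut_vector_less[of n m r i j] by (cases "i = j") auto

lemma cut_vector_le: "cut_vector n m r \<Longrightarrow> i \<le> m \<Longrightarrow> r i \<le> n"
  using cut_vector_mono[of n m r i m] by (simp add: cut_vector_def)

text \<open>Being increasing, a cut vector is recovered from its set of values at
  \<open>1, ..., m\<close>, an \<open>m\<close>-element subset of \<open>{1..n}\<close>.\<close>

lemma card_cut_vectors: "finite (cut_vectors n m)" "card (cut_vectors n m) \<le> n choose m"
proof -
  let ?\<Phi> = "\<lambda>r :: nat \<Rightarrow> nat. r ` {1..m}"
  let ?T = "{A. A \<subseteq> {1..n} \<and> card A = m}"
  have inj: "inj_on ?\<Phi> (cut_vectors n m)"
  proof (rule inj_onI, rule ext)
    fix r s i assume r: "r \<in> cut_vectors n m" and s: "s \<in> cut_vectors n m" and eq: "?\<Phi> r = ?\<Phi> s"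
    have sorted: "sorted_wrt (<) (map u [1..<Suc m])" if "u \<in> cut_vectors n m" for u
    proof -
      have cv: "cut_vector n m u" using that by (simp add: cut_vectors_def)
      show ?thesis unfolding sorted_wrt_map
        by (rule sorted_wrt_mono_rel[OF _ sorted_wrt_upt], rule cut_vector_less[OF cv]) auto
    qed
    have "set (map r [1..<Suc m]) = set (map s [1..<Suc m])"
      using eq by (simp only: set_map set_upt atLeastLessThanSuc_atLeastAtMost)
    then have "map r [1..<Suc m] = map s [1..<Suc m]"
      using sorted[OF r] sorted[OF s] by (intro strict_sorted_equal) simp_all
    then have "\<forall>i\<in>set [1..<Suc m]. r i = s i" by (simp only: map_eq_conv)
    moreover have "i \<in> set [1..<Suc m] \<or> i = 0 \<or> m < i" by (simp del: upt_Suc) linarith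
    moreover have "r 0 = s 0" "m < i \<Longrightarrow> r i = s i"
      using r s by (simp_all add: cut_vectors_def cut_vector_def)
    ultimately show "r i = s i" by blast
  qed
  have sub: "?\<Phi> ` cut_vectors n m \<subseteq> ?T"
  proof safe
    fix r i assume r: "r \<in> cut_vectors n m" and i: "i \<in> {1..m}"
    then have cv: "cut_vector n m r" by (simp add: cut_vectors_def)
    show "r i \<in> {1..n}" using cut_vector_less[OF cv, of 0 i] cut_vector_le[OF cv, of i] i by auto
  next
    fix r assume "r \<in> cut_vectors n m"
    then have cv: "cut_vector n m r" by (simp add: cut_vectors_def)
    have "inj_on r {1..m}"
      using cv unfolding cut_vector_def
      by (auto intro: inj_on_subset[OF strict_mono_on_imp_inj_on])
    then show "card (r ` {1..m}) = m" by (simp add: card_image)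
  qed
  have fin: "finite ?T" by (rule finite_subset[of _ "Pow {1..n}"]) auto
  show "finite (cut_vectors n m)" using finite_subset[OF sub fin] inj by (rule finite_imageD)
  show "card (cut_vectors n m) \<le> n choose m"
    using card_inj_on_le[OF inj sub fin] by (simp add: n_subsets)
qed

lemma block_list_update:
  "block (x[j := a]) c d = (if c \<le> j \<and> j < d then (block x c d)[j - c := a] else block x c d)"
  unfolding block_def
  by (cases "c \<le> j") (auto simp: drop_update_swap take_update_swap list_update_beyond)

text \<open>Consecutive blocks are disjoint, so a changed letter affects at most one summand, and
  that by at most 1. The opposite strings \<open>u i\<close> are arbitrary, so the bound serves both
  sequences.\<close>

lemma sum_lcs_update_diff:
  fixes s :: "nat \<Rightarrow> nat"
  assumes mono: "\<And>i i'. i \<le> i' \<Longrightarrow> i' \<le> m \<Longrightarrow> s i \<le> s i'"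
  shows "\<bar>(\<Sum>i = 1..m. real (lcs_len (block (x[j := a]) (s (i - 1)) (s i)) (u i))) -
    (\<Sum>i = 1..m. real (lcs_len (block x (s (i - 1)) (s i)) (u i)))\<bar> \<le> 1"
proof -
  let ?J = "{i \<in> {1..m}. s (i - 1) \<le> j \<and> j < s i}"
  have "\<bar>(\<Sum>i = 1..m. real (lcs_len (block (x[j := a]) (s (i - 1)) (s i)) (u i))) -
    (\<Sum>i = 1..m. real (lcs_len (block x (s (i - 1)) (s i)) (u i)))\<bar> \<le>
    (\<Sum>i = 1..m. \<bar>real (lcs_len (block (x[j := a]) (s (i - 1)) (s i)) (u i)) -
      real (lcs_len (block x (s (i - 1)) (s i)) (u i))\<bar>)"
    unfolding sum_subtractf[symmetric] by (rule sum_abs)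
  also have "\<dots> \<le> (\<Sum>i = 1..m. if s (i - 1) \<le> j \<and> j < s i then 1 else 0)"
    by (intro sum_mono) (auto simp: block_list_update lcs_len_update_diff)
  also have "\<dots> = real (card ?J)" by (subst sum.inter_filter[symmetric]) auto
  also have "card ?J \<le> 1"
  proof -
    have "i = i'" if "i \<in> ?J" "i' \<in> ?J" for i i'
    proof (rule ccontr)
      assume "i \<noteq> i'"
      then consider "i < i'" | "i' < i" by linarith
      then show False
      proof cases
        case 1
        then have "i \<le> i' - 1" "i' - 1 \<le> m" using that by auto
        then show False using that mono[of i "i' - 1"] by simp
      next
        case 2
        then have "i' \<le> i - 1" "i - 1 \<le> m" using that by auto
        then show False using that mono[of i' "i - 1"] by simp
      qed
    qed
    then show ?thesis by (simp add: card_le_Suc0_iff_eq)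
  qed
  finally show ?thesis by simp
qed

text \<open>\<open>L_cut\<close> read as a function of two strings rather than of a sample point,
  ready for McDiarmid's inequality.\<close>

definition cut_score :: "nat \<Rightarrow> nat \<Rightarrow> (nat \<Rightarrow> nat) \<Rightarrow> 'a list \<Rightarrow> 'a list \<Rightarrow> real" where
  "cut_score k m r x y =
    (\<Sum>i = 1..m. real (lcs_len (block x (k * (i - 1)) (k * i)) (block y (r (i - 1)) (r i))))"

lemma cut_score_word:
  assumes "cut_vector (k * m) m r"
  shows "cut_score k m r (word X 0 (k * m) \<omega>) (word Y 0 (k * m) \<omega>) = real (L_cut X Y k m r \<omega>)"
  unfolding cut_score_def L_cut_def of_nat_sum
  by (intro sum.cong refl) (use assms in \<open>auto simp: block_word cut_vector_le\<close>)

lemma cut_score_update_left: "\<bar>cut_score k m r (x[j := a]) y - cut_score k m r x y\<bar> \<le> 1"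
  unfolding cut_score_def
  using sum_lcs_update_diff[of m "\<lambda>i. k * i" x j a "\<lambda>i. block y (r (i - 1)) (r i)"] by simp

lemma cut_score_update_right:
  assumes "cut_vector n m r"
  shows "\<bar>cut_score k m r x (y[j := a]) - cut_score k m r x y\<bar> \<le> 1"
  using sum_lcs_update_diff[of m r y j a "\<lambda>i. block x (k * (i - 1)) (k * i)"] cut_vector_mono[OF assms]
  unfolding cut_score_def by (simp add: lcs_len_commute)

text \<open>Reduces statements about all optimal functions to the finite set of representatives, as
  a union bound needs.\<close>

lemma optimal_cut_truncate:
  assumes "optimal_cut X Y k m \<omega> r"
  shows "\<exists>s\<in>cut_vectors (k * m) m. optimal_cut X Y k m \<omega> s \<and> (\<forall>i\<le>m. s i = r i)"
proof (intro bexI conjI allI impI)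
  let ?s = "\<lambda>i. if i \<le> m then r i else 0"
  show "?s \<in> cut_vectors (k * m) m" using assms
    by (auto simp: cut_vectors_def optimal_cut_def cut_vector_def strict_mono_on_def)
  then show "optimal_cut X Y k m \<omega> ?s" using assms
    by (auto simp: cut_vectors_def optimal_cut_def L_cut_def intro!: sum.cong)
qed simp

text \<open>The lengths in \<open>Y\<close> telescope to \<open>k * m\<close>, and so do those in
  \<open>X\<close>. Hence block bounds proportional to \<open>k + l\<close> add up to a multiple of
  the total length.\<close>

lemma sum_cut_lengths:
  assumes "cut_vector (k * m) m r"
  shows "(\<Sum>i = 1..m. k + (r i - r (i - 1))) = 2 * (k * m)"
proof -
  have "(\<Sum>i = 1..j. r i - r (i - 1)) = r j" if "j \<le> m" for j
    using that
  proof (induction j)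
    case 0
    then show ?case using assms by (simp add: cut_vector_def)
  next
    case (Suc j)
    then show ?case using cut_vector_mono[OF assms, of j "Suc j"] by simp
  qed
  then show ?thesis using assms by (simp add: sum.distrib cut_vector_def mult.commute)
qed

lemma optimal_cut_cong:
  assumes "word X 0 (k * m) \<omega> = word X 0 (k * m) \<omega>'" "word Y 0 (k * m) \<omega> = word Y 0 (k * m) \<omega>'"
  shows "optimal_cut X Y k m \<omega> r \<longleftrightarrow> optimal_cut X Y k m \<omega>' r"
proof (cases "cut_vector (k * m) m r")
  case True
  then have "real (L_cut X Y k m r \<omega>) = real (L_cut X Y k m r \<omega>')"
    using assms by (simp flip: cut_score_word)
  then show ?thesis using assms by (simp add: optimal_cut_def LC_def)
qed (simp add: optimal_cut_def)

section \<open>Union bounds over cut vectors for the complements of \<open>A_event\<close> and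
  \<open>B_event\<close>\<close>

context iid_words
begin

lemma expectation_L_cut:
  assumes "cut_vector (k * m) m r"
  shows "expectation (\<lambda>\<omega>. real (L_cut X Y k m r \<omega>)) = (\<Sum>i = 1..m. mean_lcs p k (r i - r (i - 1)))"
proof -
  \<comment> \<open>Each block is rewritten as start plus length, the form in which stationarity was
    stated.\<close>
  have eq: "real (L_cut X Y k m r \<omega>) = (\<Sum>i = 1..m.
      real (lcs_len (word X (k * (i - 1)) (k * (i - 1) + k) \<omega>) (word Y (r (i - 1)) (r (i - 1) + (r i - r (i - 1))) \<omega>)))" for \<omega>
    unfolding L_cut_def of_nat_sum
  proof (intro sum.cong refl)
    fix i assume i: "i \<in> {1..m}"
    then have "k * i = k * (i - 1) + k" by (simp add: algebra_simps)
    moreover have "r i = r (i - 1) + (r i - r (i - 1))" using cut_vector_mono[OF assms, of "i - 1" i] i by simp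
    ultimately show "real (lcs_len (word X (k * (i - 1)) (k * i) \<omega>) (word Y (r (i - 1)) (r i) \<omega>)) =
       real (lcs_len (word X (k * (i - 1)) (k * (i - 1) + k) \<omega>) (word Y (r (i - 1)) (r (i - 1) + (r i - r (i - 1))) \<omega>))"
      by metis
  qed
  show ?thesis unfolding eq
    by (subst Bochner_Integration.integral_sum)
       (auto simp: integrable_words[of "\<lambda>x y. real (lcs_len x y)"]
          expectation_words[of "\<lambda>x y. real (lcs_len x y)"] mean_lcs_def intro!: sum.cong)
qed

lemma expectation_LC: "expectation (\<lambda>\<omega>. real (LC X Y n \<omega>)) = mean_lcs p n n"
  unfolding LC_def mean_lcs_def using expectation_words[of "\<lambda>x y. real (lcs_len x y)" 0 n 0 n] by simp

lemma A_event_measurable: "A_event M X Y k m a p1 p2 \<in> events"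
proof (rule events_words[where n = "k * m"])
  fix \<omega> \<omega>' assume "\<omega> \<in> A_event M X Y k m a p1 p2" "\<omega>' \<in> space M"
    "word X 0 (k * m) \<omega> = word X 0 (k * m) \<omega>'" "word Y 0 (k * m) \<omega> = word Y 0 (k * m) \<omega>'"
  then show "\<omega>' \<in> A_event M X Y k m a p1 p2"
    using optimal_cut_cong[of X k m \<omega> \<omega>' Y] by (simp add: A_event_def)
qed (auto simp: A_event_def)

lemma B_event_measurable: "B_event M X Y k m P \<epsilon> \<in> events"
proof (rule events_words[where n = "k * m"])
  fix \<omega> \<omega>' assume \<omega>: "\<omega> \<in> B_event M X Y k m P \<epsilon>" "\<omega>' \<in> space M"
    and eq: "word X 0 (k * m) \<omega> = word X 0 (k * m) \<omega>'" "word Y 0 (k * m) \<omega> = word Y 0 (k * m) \<omega>'"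
  have "{i \<in> {1..m}. P (word X ((i - 1) * k) (i * k) \<omega>) (word Y (r (i - 1)) (r i) \<omega>)} =
    {i \<in> {1..m}. P (word X ((i - 1) * k) (i * k) \<omega>') (word Y (r (i - 1)) (r i) \<omega>')}"
    if "optimal_cut X Y k m \<omega>' r" for r
  proof (intro Collect_cong conj_cong refl)
    fix i assume "i \<in> {1..m}"
    then have "i * k \<le> k * m" "r i \<le> k * m"
      using that by (auto simp: optimal_cut_def cut_vector_le mult.commute)
    then show "P (word X ((i - 1) * k) (i * k) \<omega>) (word Y (r (i - 1)) (r i) \<omega>) =
       P (word X ((i - 1) * k) (i * k) \<omega>') (word Y (r (i - 1)) (r i) \<omega>')"
      using word_cong[OF eq(1)] word_cong[OF eq(2)] by simp
  qed
  then show "\<omega>' \<in> B_event M X Y k m P \<epsilon>"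
    using \<omega> optimal_cut_cong[OF eq] by (simp add: B_event_def)
qed (auto simp: B_event_def)

text \<open>The gap \<open>d\<close> is split: \<open>d - \<delta>\<close> pays for the distance
  between the mean optimum and its limiting value (hypothesis \<open>large\<close>), and
  \<open>\<delta>\<close> remains as the deviation that McDiarmid's inequality makes
  unlikely.\<close>

lemma prob_not_A_event_le:
  fixes \<gamma> d \<eta> :: real
  assumes km: "k \<ge> 1" "m \<ge> 1" and a: "0 < a" and \<delta>: "0 < \<delta>" and d: "0 \<le> d"
    and mean_le: "\<And>k l. mean_lcs p k l \<le> \<gamma> * real (k + l) / 2"
    and mean_bad: "\<And>k l. real l < real k * p1 \<or> real k * p2 < real l \<Longrightarrow>
      mean_lcs p k l \<le> (\<gamma> - d) * real (k + l) / 2"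
    and large: "mean_lcs p (k * m) (k * m) \<ge> (\<gamma> - (d - \<delta>) * a / 2) * real (k * m)"
  shows "prob (space M - A_event M X Y k m a p1 p2) \<le>
    exp (- real (k * m) * (- (1 + ln (real k)) / real k + \<delta>\<^sup>2 * a\<^sup>2 / 16))"
proof -
  let ?n = "k * m"
  let ?in = "\<lambda>r. {i \<in> {1..m}. real k * p1 \<le> real (r i - r (i - 1)) \<and> real (r i - r (i - 1)) \<le> real k * p2}"
  \<comment> \<open>These are the cuts whose optimality would violate \<open>A_event\<close>;
    membership does not depend on the sample point.\<close>
  define R where "R = {r \<in> cut_vectors ?n m. \<not> real (card (?in r)) \<ge> (1 - a) * real m}"
  \<comment> \<open>At an optimal cut both scores agree, so \<open>?W r\<close> contains every
    sample point for which \<open>r\<close> is optimal.\<close>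
  define F where "F r x y = cut_score k m r x y - real (lcs_len x y)" for r and x y :: "'a list"
  let ?W = "\<lambda>r. {\<omega> \<in> space M. F r (word X 0 ?n \<omega>) (word Y 0 ?n \<omega>) \<ge> 0}"
  define t where "t = \<delta> * a / 2 * real ?n"
  have n: "0 < ?n" using km by simp
  have t: "0 < t" using n a \<delta> by (simp add: t_def)
  have R: "finite R" "real (card R) \<le> (exp 1 * real k) ^ m"
  proof -
    have sub: "R \<subseteq> cut_vectors ?n m" by (auto simp: R_def)
    then show "finite R" using card_cut_vectors(1) by (rule finite_subset)
    have "card R \<le> ?n choose m"
      using card_mono[OF card_cut_vectors(1) sub] card_cut_vectors(2)[of ?n m] by simp
    then show "real (card R) \<le> (exp 1 * real k) ^ m"
      using binomial_mult_le_exp[OF km(2), of k] by linarith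
  qed
  have F_word: "F r (word X 0 ?n \<omega>) (word Y 0 ?n \<omega>) = real (L_cut X Y k m r \<omega>) - real (LC X Y ?n \<omega>)"
    if "r \<in> R" for r \<omega>
    using that by (simp add: F_def R_def cut_vectors_def cut_score_word LC_def)
  have W: "?W r \<in> events" for r
    by (rule events_words[where n = ?n]) auto
  have sub: "space M - A_event M X Y k m a p1 p2 \<subseteq> (\<Union>r\<in>R. ?W r)"
  proof
    fix \<omega> assume "\<omega> \<in> space M - A_event M X Y k m a p1 p2"
    then obtain r where \<omega>: "\<omega> \<in> space M" and r: "optimal_cut X Y k m \<omega> r" "\<not> real (card (?in r)) \<ge> (1 - a) * real m"
      by (auto simp: A_event_def)
    obtain s where s: "s \<in> cut_vectors ?n m" "optimal_cut X Y k m \<omega> s" "\<forall>i\<le>m. s i = r i"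
      using optimal_cut_truncate[OF r(1)] by blast
    have "?in s = ?in r" using s(3) by auto
    then have "s \<in> R" using s(1) r(2) by (simp add: R_def)
    moreover from this have "\<omega> \<in> ?W s" using \<omega> s(2) by (simp add: F_word optimal_cut_def)
    ultimately show "\<omega> \<in> (\<Union>r\<in>R. ?W r)" by blast
  qed
  have W_le: "prob (?W r) \<le> exp (- (\<delta>\<^sup>2 * a\<^sup>2 / 16) * real ?n)" if r: "r \<in> R" for r
  proof -
    have cv: "cut_vector ?n m r" using r by (simp add: R_def cut_vectors_def)
    let ?l = "\<lambda>i. k + (r i - r (i - 1))"
    let ?out = "{1..m} - ?in r"
    have "card ?out = m - card (?in r)" by (subst card_Diff_subset) auto
    moreover have "card (?in r) \<le> card {1..m}" by (rule card_mono) auto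
    ultimately have "real (card ?out) = real m - real (card (?in r))" by simp
    then have out: "a * real m \<le> real (card ?out)" using r by (simp add: R_def algebra_simps)
    have "(\<Sum>i = 1..m. mean_lcs p k (r i - r (i - 1))) \<le>
       (\<Sum>i = 1..m. \<gamma> * real (?l i) / 2 - (if i \<in> ?out then d * real k / 2 else 0))"
    proof (intro sum_mono)
      fix i assume i: "i \<in> {1..m}"
      have "mean_lcs p k (r i - r (i - 1)) \<le> \<gamma> * real (?l i) / 2 - d * real k / 2" if "i \<in> ?out"
      proof -
        have "mean_lcs p k (r i - r (i - 1)) \<le> (\<gamma> - d) * real (?l i) / 2"
          using that i by (intro mean_bad) auto
        \<comment> \<open>Only the saving due to the \<open>k\<close> letters of \<open>X\<close> is
          kept, since an inadmissible string of \<open>Y\<close> may be short.\<close>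
        also have "\<dots> \<le> \<gamma> * real (?l i) / 2 - d * real k / 2"
          using mult_nonneg_nonneg[OF d, of "real (r i - r (i - 1))"] by (simp add: field_simps)
        finally show ?thesis .
      qed
      then show "mean_lcs p k (r i - r (i - 1)) \<le>
          \<gamma> * real (?l i) / 2 - (if i \<in> ?out then d * real k / 2 else 0)"
        using mean_le[of k "r i - r (i - 1)"] by simp
    qed
    also have "\<dots> = (\<Sum>i = 1..m. \<gamma> * real (?l i) / 2) - d * real k / 2 * real (card ?out)"
    proof -
      have "(\<Sum>i = 1..m. if i \<in> ?out then d * real k / 2 else 0) = d * real k / 2 * real (card ?out)"
        by (subst sum.inter_restrict[symmetric]) (auto intro!: arg_cong[where f = card])
      then show ?thesis by (simp only: sum_subtractf)
    qed
    also have "(\<Sum>i = 1..m. \<gamma> * real (?l i) / 2) = \<gamma> * real (\<Sum>i = 1..m. ?l i) / 2"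
      by (simp only: of_nat_sum sum_distrib_left sum_divide_distrib)
    also have "\<dots> = \<gamma> * real ?n" using sum_cut_lengths[OF cv] by simp
    finally have "(\<Sum>i = 1..m. mean_lcs p k (r i - r (i - 1))) \<le> \<gamma> * real ?n - d * real k / 2 * real (card ?out)" .
    moreover have "d * real k / 2 * (a * real m) \<le> d * real k / 2 * real (card ?out)"
      using d out by (intro mult_left_mono) auto
    moreover have "d * real k / 2 * (a * real m) = d * a / 2 * real ?n" by simp
    ultimately have "(\<Sum>i = 1..m. mean_lcs p k (r i - r (i - 1))) \<le> \<gamma> * real ?n - d * a / 2 * real ?n"
      by linarith
    \<comment> \<open>Of the loss \<open>d * a / 2 * n\<close>, hypothesis \<open>large\<close>
      gives back at most the share with \<open>d - \<delta>\<close>, which leaves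
      \<open>t\<close>.\<close>
    then have mean: "(\<Sum>i = 1..m. mean_lcs p k (r i - r (i - 1))) - mean_lcs p ?n ?n \<le> - t"
      using large by (simp add: t_def field_simps)
    have "expectation (\<lambda>\<omega>. F r (word X 0 ?n \<omega>) (word Y 0 ?n \<omega>)) =
        expectation (\<lambda>\<omega>. real (L_cut X Y k m r \<omega>)) - expectation (\<lambda>\<omega>. real (LC X Y ?n \<omega>))"
      unfolding F_word[OF r]
      using integrable_words[of "cut_score k m r" 0 ?n 0 ?n] integrable_words[of "\<lambda>x y. real (lcs_len x y)" 0 ?n 0 ?n]
      by (intro Bochner_Integration.integral_diff) (simp_all add: cut_score_word[OF cv] LC_def)
    also have "\<dots> \<le> - t" using mean by (simp add: expectation_L_cut[OF cv] expectation_LC)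
    finally have "expectation (\<lambda>\<omega>. F r (word X 0 ?n \<omega>) (word Y 0 ?n \<omega>)) \<le> - t" .
    \<comment> \<open>The difference constant 2 is 1 for the score of the cut plus 1 for the
      optimum.\<close>
    then have "prob (?W r) \<le> exp (- t\<^sup>2 / (real ?n * 2\<^sup>2))"
    proof (intro prob_concentration n t)
      fix x y :: "'a list" and j b
      show "\<bar>F r (x[j := b]) y - F r x y\<bar> \<le> 2"
        using cut_score_update_left[of k m r x j b y] lcs_len_update_diff[of x j b y] unfolding F_def by linarith
      show "\<bar>F r x (y[j := b]) - F r x y\<bar> \<le> 2"
        using cut_score_update_right[OF cv, of k x y j b] lcs_len_update_diff[of y j b x]
        unfolding F_def lcs_len_commute[of x] by linarith
    qed auto
    also have "- t\<^sup>2 / (real ?n * 2\<^sup>2) = - (\<delta>\<^sup>2 * a\<^sup>2 / 16) * real ?n"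
      using n by (simp add: t_def field_simps power2_eq_square)
    finally show ?thesis .
  qed
  have "prob (space M - A_event M X Y k m a p1 p2) \<le> prob (\<Union>r\<in>R. ?W r)"
    using sub W R by (intro finite_measure_mono sets.finite_UN) auto
  also have "\<dots> \<le> (\<Sum>r\<in>R. prob (?W r))"
    using R W by (intro finite_measure_subadditive_finite) auto
  also have "\<dots> \<le> (\<Sum>r\<in>R. exp (- (\<delta>\<^sup>2 * a\<^sup>2 / 16) * real ?n))"
    by (intro sum_mono W_le)
  also have "\<dots> \<le> (exp 1 * real k) ^ m * exp (- (\<delta>\<^sup>2 * a\<^sup>2 / 16) * real ?n)"
    using R by (simp add: mult_right_mono)
  also have "(exp 1 * real k) ^ m = exp ((1 + ln (real k)) * real m)"
    using km by (simp add: exp_add exp_of_nat2_mult power_mult_distrib)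
  also have "\<dots> * exp (- (\<delta>\<^sup>2 * a\<^sup>2 / 16) * real ?n) =
      exp (- real ?n * (- (1 + ln (real k)) / real k + \<delta>\<^sup>2 * a\<^sup>2 / 16))"
    using km by (simp add: exp_add[symmetric] field_simps)
  finally show ?thesis .
qed

text \<open>Induction over the blocks from the left: a block in \<open>S\<close> is independent of
  the prefix before it and contributes a factor \<open>q\<close>, a block outside \<open>S\<close>
  leaves the event unchanged.\<close>

lemma prob_blocks_le:
  assumes cv: "cut_vector (k * m) m r" and S: "S \<subseteq> {1..m}" and q: "0 \<le> q"
    and bad: "\<And>i. i \<in> S \<Longrightarrow>
      measure_pmf.prob (pair_pmf (replicate_pmf k p) (replicate_pmf (r i - r (i - 1)) p)) {(x, y). Q x y} \<le> q"
  shows "prob {\<omega> \<in> space M. \<forall>i\<in>S. Q (word X ((i - 1) * k) (i * k) \<omega>) (word Y (r (i - 1)) (r i) \<omega>)} \<le> q ^ card S"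
proof -
  have "prob {\<omega> \<in> space M. \<forall>i\<in>S. i \<le> j \<longrightarrow> Q (word X ((i - 1) * k) (i * k) \<omega>) (word Y (r (i - 1)) (r i) \<omega>)}
      \<le> q ^ card (S \<inter> {..j})" if "j \<le> m" for j
    using that
  proof (induction j)
    case 0
    have "S \<inter> {..0} = {}" using S by auto
    then show ?case by simp
  next
    case (Suc j)
    show ?case
    proof (cases "Suc j \<in> S")
      case False
      then have "S \<inter> {..Suc j} = S \<inter> {..j}" "\<And>i. i \<in> S \<Longrightarrow> i \<le> Suc j \<longleftrightarrow> i \<le> j"
        by (auto simp: le_Suc_eq)
      then show ?thesis using Suc by simp
    next
      case True
      \<comment> \<open>With \<open>block\<close>, the conditions on earlier blocks become a
        predicate of the two prefixes, as \<open>prob_words_indep\<close> demands.\<close>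
      let ?Q = "\<lambda>x y. \<forall>i\<in>S. i \<le> j \<longrightarrow> Q (block x ((i - 1) * k) (i * k)) (block y (r (i - 1)) (r i))"
      let ?d = "r (Suc j) - r j"
      have d: "r j + ?d = r (Suc j)" using cut_vector_mono[OF cv, of j "Suc j"] Suc.prems by simp
      have Q: "?Q (word X 0 (j * k) \<omega>) (word Y 0 (r j) \<omega>) \<longleftrightarrow>
        (\<forall>i\<in>S. i \<le> j \<longrightarrow> Q (word X ((i - 1) * k) (i * k) \<omega>) (word Y (r (i - 1)) (r i) \<omega>))" for \<omega>
        using cut_vector_mono[OF cv, of _ j] Suc.prems by (auto simp: block_word)
      have "{\<omega> \<in> space M. \<forall>i\<in>S. i \<le> Suc j \<longrightarrow> Q (word X ((i - 1) * k) (i * k) \<omega>) (word Y (r (i - 1)) (r i) \<omega>)} =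
        {\<omega> \<in> space M. ?Q (word X 0 (j * k) \<omega>) (word Y 0 (r j) \<omega>) \<and>
          Q (word X (j * k) (j * k + k) \<omega>) (word Y (r j) (r j + ?d) \<omega>)}"
        unfolding Q d using True by (auto simp: le_Suc_eq add.commute)
      then have "prob {\<omega> \<in> space M. \<forall>i\<in>S. i \<le> Suc j \<longrightarrow> Q (word X ((i - 1) * k) (i * k) \<omega>) (word Y (r (i - 1)) (r i) \<omega>)} =
        prob {\<omega> \<in> space M. ?Q (word X 0 (j * k) \<omega>) (word Y 0 (r j) \<omega>)} *
        prob {\<omega> \<in> space M. Q (word X (j * k) (j * k + k) \<omega>) (word Y (r j) (r j + ?d) \<omega>)}"
        by (simp only: prob_words_indep[of ?Q "j * k" "r j" Q k ?d])
      also have "\<dots> \<le> q ^ card (S \<inter> {..j}) * q"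
        unfolding Q prob_words[of Q "j * k" k "r j" ?d] using Suc bad[OF True] q by (intro mult_mono) auto
      also have "S \<inter> {..Suc j} = insert (Suc j) (S \<inter> {..j})" using True by (auto simp: le_Suc_eq)
      then have "q ^ card (S \<inter> {..j}) * q = q ^ card (S \<inter> {..Suc j})" by simp
      finally show ?thesis .
    qed
  qed
  from this[of m] show ?thesis using S by (simp add: Int_absorb2 subset_iff)
qed

text \<open>The level \<open>2 * a\<close> is spent in halves: on \<open>A_event\<close> at most
  \<open>a * m\<close> blocks are inadmissible, so more than \<open>2 * a * m\<close> pairs without
  \<open>P\<close> include at least \<open>a * m\<close> admissible ones. Selecting exactly
  \<open>j\<close> of these keeps the union over sets of one size.\<close>

lemma prob_B_event_ge:
  assumes km: "k \<ge> 1" "m \<ge> 1" and a: "0 < a" "a < 1"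
    and bad: "\<And>l. real k * p1 \<le> real l \<Longrightarrow> real l \<le> real k * p2 \<Longrightarrow>
      prob {\<omega> \<in> space M. \<not> P (word X 0 k \<omega>) (word Y 0 l \<omega>)} \<le> 1 / (2 * exp 1 * real k) powr (1 / a)"
  shows "prob (B_event M X Y k m P (2 * a)) \<ge>
    1 - prob (space M - A_event M X Y k m a p1 p2) - exp ((H_e a - ln 2) * real m)"
proof -
  let ?n = "k * m"
  let ?in = "\<lambda>r. {i \<in> {1..m}. real k * p1 \<le> real (r i - r (i - 1)) \<and> real (r i - r (i - 1)) \<le> real k * p2}"
  let ?ok = "\<lambda>r \<omega>. {i \<in> {1..m}. P (word X ((i - 1) * k) (i * k) \<omega>) (word Y (r (i - 1)) (r i) \<omega>)}"
  define b where "b = 2 * exp 1 * real k"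
  define q where "q = 1 / b powr (1 / a)"
  define j where "j = nat \<lceil>a * real m\<rceil>"
  define T where "T r = {S. S \<subseteq> ?in r \<and> card S = j}" for r
  define E where "E r S = {\<omega> \<in> space M. \<forall>i\<in>S. \<not> P (word X ((i - 1) * k) (i * k) \<omega>) (word Y (r (i - 1)) (r i) \<omega>)}"
    for r S
  define U where "U = (\<Union>r\<in>cut_vectors ?n m. \<Union>S\<in>T r. E r S)"
  have b: "exp 1 \<le> b" "0 < b" using km by (auto simp: b_def)
  have q: "0 < q" "q \<le> a"
  proof -
    show "0 < q" using b by (simp add: q_def)
    \<comment> \<open>The entropy bound requires \<open>q \<le> a\<close>; this follows from
      \<open>1 / a \<le> exp (1 / a)\<close> and \<open>exp 1 \<le> b\<close>.\<close>
    have "1 / a \<le> exp (1 / a)" using exp_ge_add_one_self[of "1 / a"] by linarith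
    also have "\<dots> = exp 1 powr (1 / a)" by (simp add: powr_def)
    also have "\<dots> \<le> b powr (1 / a)" using b a by (intro powr_mono2) auto
    finally show "q \<le> a" using a b by (simp add: q_def field_simps)
  qed
  have T: "finite (T r)" "card (T r) \<le> m choose j" for r
  proof -
    have sub: "T r \<subseteq> {S. S \<subseteq> {1..m} \<and> card S = j}" by (auto simp: T_def)
    have fin: "finite {S. S \<subseteq> {1..m} \<and> card S = j}" by (rule finite_subset[of _ "Pow {1..m}"]) auto
    show "finite (T r)" using sub fin by (rule finite_subset)
    show "card (T r) \<le> m choose j" using card_mono[OF fin sub] by (simp add: n_subsets)
  qed
  have E: "E r S \<in> events" "prob (E r S) \<le> q ^ j" if r: "r \<in> cut_vectors ?n m" and S: "S \<in> T r" for r S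
  proof -
    have cv: "cut_vector ?n m r" using r by (simp add: cut_vectors_def)
    show "E r S \<in> events"
    proof (rule events_words[where n = ?n])
      fix \<omega> \<omega>' assume *: "\<omega> \<in> E r S" "\<omega>' \<in> space M"
        "word X 0 ?n \<omega> = word X 0 ?n \<omega>'" "word Y 0 ?n \<omega> = word Y 0 ?n \<omega>'"
      have "i * k \<le> ?n" "r i \<le> ?n" if "i \<in> S" for i
        using that S cut_vector_le[OF cv, of i] by (auto simp: T_def mult.commute)
      then show "\<omega>' \<in> E r S"
        using * word_cong[OF *(3)] word_cong[OF *(4)] by (simp add: E_def)
    qed (auto simp: E_def)
    have "prob (E r S) \<le> q ^ card S"
      unfolding E_def
    proof (rule prob_blocks_le[OF cv, where Q = "\<lambda>x y. \<not> P x y"])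
      fix i assume "i \<in> S"
      then have "i \<in> ?in r" using S by (auto simp: T_def)
      then have "prob {\<omega> \<in> space M. \<not> P (word X 0 k \<omega>) (word Y 0 (r i - r (i - 1)) \<omega>)} \<le> q"
        using bad[of "r i - r (i - 1)"] by (simp add: q_def b_def)
      then show "measure_pmf.prob (pair_pmf (replicate_pmf k p) (replicate_pmf (r i - r (i - 1)) p)) {(x, y). \<not> P x y} \<le> q"
        using prob_words[of "\<lambda>x y. \<not> P x y" 0 k 0 "r i - r (i - 1)"] by simp
    qed (use q S in \<open>auto simp: T_def\<close>)
    then show "prob (E r S) \<le> q ^ j" using S by (simp add: T_def)
  qed
  have U_ev: "U \<in> events"
    unfolding U_def using card_cut_vectors(1) T(1) E(1) by (intro sets.finite_UN) auto
  have "prob U \<le> (\<Sum>r\<in>cut_vectors ?n m. prob (\<Union>S\<in>T r. E r S))"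
    unfolding U_def using card_cut_vectors(1) T(1) E(1)
    by (intro finite_measure_subadditive_finite) (auto intro!: sets.finite_UN)
  also have "\<dots> \<le> (\<Sum>r\<in>cut_vectors ?n m. \<Sum>S\<in>T r. prob (E r S))"
    using T(1) E(1) by (intro sum_mono finite_measure_subadditive_finite) auto
  also have "\<dots> \<le> (\<Sum>r\<in>cut_vectors ?n m. \<Sum>S\<in>T r. q ^ j)"
    using E(2) by (intro sum_mono) auto
  also have "\<dots> \<le> (\<Sum>r\<in>cut_vectors ?n m. real (m choose j) * q ^ j)"
    using T(2) q by (intro sum_mono) (simp add: mult_right_mono)
  also have "\<dots> = real (card (cut_vectors ?n m)) * (real (m choose j) * q ^ j)" by simp
  also have "\<dots> \<le> (exp 1 * real k) ^ m * (exp (H_e a * real m) * q powr (a * real m))"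
  proof (rule mult_mono)
    show "real (card (cut_vectors ?n m)) \<le> (exp 1 * real k) ^ m"
      using card_cut_vectors(2)[of ?n m] binomial_mult_le_exp[OF km(2), of k] by linarith
    show "real (m choose j) * q ^ j \<le> exp (H_e a * real m) * q powr (a * real m)"
      using a q by (intro binomial_power_le_entropy) (auto simp: j_def)
  qed (use q in auto)
  \<comment> \<open>The exponent \<open>1 / a\<close> in the hypothesis is made for this:
    \<open>a * m\<close> bad blocks gain the factor \<open>b ^ m\<close>, which exceeds the bound on
    the number of cuts by \<open>2 ^ m\<close>.\<close>
  also have "q powr (a * real m) = 1 / b ^ m"
    using a b by (simp add: q_def powr_divide powr_powr powr_realpow)
  also have "(exp 1 * real k) ^ m * (exp (H_e a * real m) * (1 / b ^ m)) = exp (H_e a * real m) / 2 ^ m"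
    using km by (simp add: b_def power_mult_distrib field_simps)
  also have "\<dots> = exp ((H_e a - ln 2) * real m)"
    by (simp add: exp_diff left_diff_distrib exp_of_nat2_mult)
  finally have U: "prob U \<le> exp ((H_e a - ln 2) * real m)" .
  have "space M \<subseteq> B_event M X Y k m P (2 * a) \<union> ((space M - A_event M X Y k m a p1 p2) \<union> U)"
  proof (rule subsetI, rule ccontr)
    fix \<omega> assume "\<omega> \<in> space M"
      "\<omega> \<notin> B_event M X Y k m P (2 * a) \<union> ((space M - A_event M X Y k m a p1 p2) \<union> U)"
    then have \<omega>: "\<omega> \<in> space M" "\<omega> \<notin> U" "\<omega> \<in> A_event M X Y k m a p1 p2"
      and not_B: "\<omega> \<notin> B_event M X Y k m P (2 * a)" by auto
    from not_B obtain r where r: "optimal_cut X Y k m \<omega> r" "\<not> real (card (?ok r \<omega>)) / real m \<ge> 1 - 2 * a"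
      using \<omega>(1) by (auto simp: B_event_def)
    obtain s where s: "s \<in> cut_vectors ?n m" "optimal_cut X Y k m \<omega> s" "\<forall>i\<le>m. s i = r i"
      using optimal_cut_truncate[OF r(1)] by blast
    have "?ok s \<omega> = ?ok r \<omega>" using s(3) by auto
    then have ok: "real (card (?ok s \<omega>)) < (1 - 2 * a) * real m"
      using r(2) km by (simp add: field_simps)
    have "(1 - a) * real m \<le> real (card (?in s))" using \<omega>(3) s(2) by (simp add: A_event_def)
    moreover have "card (?in s) \<le> card (?in s - ?ok s \<omega>) + card (?ok s \<omega>)"
      using card_Un_le[of "?in s - ?ok s \<omega>" "?ok s \<omega>"]
      by (rule order.trans[rotated]) (auto intro!: card_mono)
    ultimately have "a * real m \<le> real (card (?in s - ?ok s \<omega>))"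
      using ok by (simp add: algebra_simps)
    then have "j \<le> card (?in s - ?ok s \<omega>)" by (simp add: j_def)
    then obtain S where S: "S \<subseteq> ?in s - ?ok s \<omega>" "card S = j"
      by (rule obtain_subset_with_card_n)
    then have "S \<in> T s" "\<omega> \<in> E s S" using \<omega>(1) by (auto simp: T_def E_def)
    then show False using \<omega>(2) s(1) by (auto simp: U_def)
  qed
  then have "prob (space M) \<le> prob (B_event M X Y k m P (2 * a) \<union> ((space M - A_event M X Y k m a p1 p2) \<union> U))"
    using U_ev A_event_measurable B_event_measurable by (intro finite_measure_mono) auto
  also have "\<dots> \<le> prob (B_event M X Y k m P (2 * a)) + prob ((space M - A_event M X Y k m a p1 p2) \<union> U)"
    using U_ev A_event_measurable B_event_measurable by (intro measure_Un_le) auto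
  also have "prob ((space M - A_event M X Y k m a p1 p2) \<union> U) \<le> prob (space M - A_event M X Y k m a p1 p2) + prob U"
    using U_ev A_event_measurable by (intro measure_Un_le) auto
  finally show ?thesis using U by (simp add: prob_space)
qed

end

section \<open>From the given random variables to a pmf of letters, and the choice of the
  threshold\<close>

theorem theorem5p1:
  fixes M :: "'w measure" and X Y :: "nat \<Rightarrow> 'w \<Rightarrow> 'a::finite"
    and \<epsilon> \<delta> p1 p2 :: real
  assumes "prob_space M"
    and "prob_space.indep_vars M (\<lambda>_. count_space UNIV) (case_sum X Y) ({1..} <+> {1..})"
    and "\<And>i. i \<ge> 1 \<Longrightarrow> distr M (count_space UNIV) (X i) = distr M (count_space UNIV) (X 1)"
    and "\<And>i. i \<ge> 1 \<Longrightarrow> distr M (count_space UNIV) (Y i) = distr M (count_space UNIV) (X 1)"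
    and "\<not> (\<exists>a. AE \<omega> in M. X 1 \<omega> = a)"
    and "0 < \<epsilon>" and "\<epsilon> < 1"
    and "0 < p1" and "p1 < 1" and "1 < p2"
    and "gamma_tilde M X Y p1 < gamma_star M X Y"
    and "gamma_tilde M X Y p2 < gamma_star M X Y"
    and "0 < \<delta>"
    and "\<delta> < min (gamma_star M X Y - gamma_tilde M X Y p1)
                 (gamma_star M X Y - gamma_tilde M X Y p2)"
  shows "\<exists>n0::nat. \<forall>(P :: 'a list \<Rightarrow> 'a list \<Rightarrow> bool) (k::nat).
    k \<ge> 1 \<and>
    (MAX l \<in> {l::nat. real k * p1 \<le> real l \<and> real l \<le> real k * p2}.
        measure M {\<omega> \<in> space M. \<not> P (word X 0 k \<omega>) (word Y 0 l \<omega>)})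
      \<le> 1 / (2 * exp 1 * real k) powr (2 / \<epsilon>)
    \<longrightarrow>
    (\<forall>m\<ge>1.
       measure M (B_event M X Y k m P \<epsilon>)
         \<ge> 1 - measure M (space M - A_event M X Y k m (\<epsilon> / 2) p1 p2)
             - exp ((H_e (\<epsilon> / 2) - ln 2) * real m)) \<and>
    (\<forall>m\<ge>1. \<forall>n. n = k * m \<and> n \<ge> n0 \<longrightarrow>
       measure M (B_event M X Y k m P \<epsilon>)
         \<ge> 1 - exp (- real n * (- (1 + ln (real k)) / real k + \<delta>\<^sup>2 * \<epsilon>\<^sup>2 / 64))
             - exp (real n / real k * (H_e (\<epsilon> / 2) - ln 2)))"
proof -
  interpret prob_space M by fact
  define D where "D = distr M (count_space UNIV) (X 1)"
  have rv: "case_sum X Y j \<in> measurable M (count_space UNIV)" if "j \<in> {1..} <+> {1..}" for j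
    using assms(2) that unfolding indep_vars_def by blast
  have rv_X: "X i \<in> measurable M (count_space UNIV)" and rv_Y: "Y i \<in> measurable M (count_space UNIV)"
    if "i \<ge> 1" for i
    using rv[of "Inl i"] rv[of "Inr i"] that by auto
  interpret D: prob_space D unfolding D_def by (rule prob_space_distr) (simp add: rv_X)
  have "(\<Sum>a\<in>UNIV. D.prob {a}) = D.prob UNIV"
    by (rule D.finite_measure_eq_sum_singleton[symmetric]) (auto simp: D_def)
  then have sum1: "(\<Sum>a\<in>UNIV. D.prob {a}) = 1" using D.prob_space by (simp add: D_def)
  \<comment> \<open>The common law of the letters is recast as a pmf on the finite alphabet.\<close>
  define p where "p = embed_pmf (\<lambda>a. D.prob {a})"
  have p: "pmf p a = D.prob {a}" for a
    unfolding p_def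
    by (rule pmf_embed_pmf) (auto simp: nn_integral_count_space_finite sum1)
  interpret iid_words M X Y p
  proof
    show "indep_vars (\<lambda>_. count_space UNIV) (case_sum X Y) ({1..} <+> {1..})" by fact
    fix i :: nat and a assume i: "1 \<le> i"
    have "prob {\<omega> \<in> space M. X i \<omega> = a} = measure (distr M (count_space UNIV) (X i)) {a}"
      by (subst measure_distr[OF rv_X[OF i]]) (auto intro!: arg_cong[where f = prob])
    then show "prob {\<omega> \<in> space M. X i \<omega> = a} = pmf p a"
      unfolding p D_def assms(3)[OF i] .
    have "prob {\<omega> \<in> space M. Y i \<omega> = a} = measure (distr M (count_space UNIV) (Y i)) {a}"
      by (subst measure_distr[OF rv_Y[OF i]]) (auto intro!: arg_cong[where f = prob])
    then show "prob {\<omega> \<in> space M. Y i \<omega> = a} = pmf p a"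
      unfolding p D_def assms(4)[OF i] .
  qed
  let ?\<gamma> = "gamma_star M X Y"
  have mean: "(\<integral>\<omega>. real (lcs_len (word X 0 n \<omega>) (word Y 0 l \<omega>)) \<partial>M) = mean_lcs p n l" for n l
    using expectation_words[of "\<lambda>x y. real (lcs_len x y)" 0 n 0 l] by (simp add: mean_lcs_def)
  have tilde_bound: "mean_lcs p n (nat \<lceil>real n * q\<rceil>) \<le> gamma_tilde M X Y q * (real n * (1 + q) / 2) + 1"
      "0 \<le> gamma_tilde M X Y q" if q: "0 < q" for q n
  proof -
    obtain g where g: "(\<lambda>n. mean_lcs p n (nat \<lceil>real n * q\<rceil>) / (real n * (1 + q) / 2)) \<longlonglongrightarrow> g"
      "\<And>n. mean_lcs p n (nat \<lceil>real n * q\<rceil>) \<le> g * (real n * (1 + q) / 2) + 1" "0 \<le> g"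
      by (rule mean_lcs_limit[where p = p, OF q]) (rule that)
    \<comment> \<open>As \<open>lim\<close> is a definite description, its value is identified
      through the convergence just obtained.\<close>
    have "gamma_tilde M X Y q = g" unfolding gamma_tilde_def mean by (rule limI) (rule g(1))
    with g show "mean_lcs p n (nat \<lceil>real n * q\<rceil>) \<le> gamma_tilde M X Y q * (real n * (1 + q) / 2) + 1"
      "0 \<le> gamma_tilde M X Y q" by simp_all
  qed
  \<comment> \<open>At \<open>q = 1\<close> nothing is rounded and the normalisation is
    \<open>n\<close>, so the same lemma yields \<open>gamma_star\<close>.\<close>
  obtain g where "(\<lambda>n. mean_lcs p n (nat \<lceil>real n * 1\<rceil>) / (real n * (1 + 1) / 2)) \<longlonglongrightarrow> g"
    "\<And>n. mean_lcs p n (nat \<lceil>real n * 1\<rceil>) \<le> g * (real n * (1 + 1) / 2) + 1" and g0: "0 \<le> g"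
    by (rule mean_lcs_limit[where p = p, OF zero_less_one]) (rule that)
  then have g: "(\<lambda>n. mean_lcs p n n / real n) \<longlonglongrightarrow> g" "\<And>n. mean_lcs p n n \<le> g * real n + 1"
    by simp_all
  have "?\<gamma> = g" unfolding gamma_star_def expectation_LC using g(1) by (rule limI)
  with g g0 have lim: "(\<lambda>n. mean_lcs p n n / real n) \<longlonglongrightarrow> ?\<gamma>"
    and star: "\<And>n. mean_lcs p n n \<le> ?\<gamma> * real n + 1" "0 \<le> ?\<gamma>" by simp_all
  define d where "d = min (?\<gamma> - gamma_tilde M X Y p1) (?\<gamma> - gamma_tilde M X Y p2)"
  have d: "\<delta> < d" "d \<le> ?\<gamma> - gamma_tilde M X Y p1" "d \<le> ?\<gamma> - gamma_tilde M X Y p2"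
    using assms(14) by (simp_all add: d_def)
  have mean_bad: "mean_lcs p k l \<le> (?\<gamma> - d) * real (k + l) / 2"
    if out: "real l < real k * p1 \<or> real k * p2 < real l" for k l
  proof -
    \<comment> \<open>Strings that are too short are compared with slope \<open>p1\<close>, those
      that are too long with \<open>p2\<close>.\<close>
    obtain q where q: "0 < q" "gamma_tilde M X Y q < ?\<gamma>" "gamma_tilde M X Y q \<le> ?\<gamma> - d"
      and side: "(real l < real k * q \<and> q < 1) \<or> (real k * q < real l \<and> 1 < q)"
    proof (cases "real l < real k * p1")
      case True
      show ?thesis by (rule that[of p1]) (use True assms(8,9,11) d in auto)
    next
      case False
      show ?thesis by (rule that[of p2]) (use False out assms(10,12) d in auto)
    qed
    have "mean_lcs p k l \<le> gamma_tilde M X Y q * real (k + l) / 2"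
      by (rule mean_lcs_le_of_slope[OF lim q(2,1) tilde_bound(2,1)[OF q(1)] side])
    also have "\<dots> \<le> (?\<gamma> - d) * real (k + l) / 2"
      using q(3) by (intro divide_right_mono mult_right_mono) auto
    finally show ?thesis .
  qed
  define a where "a = \<epsilon> / 2"
  have a: "0 < a" "a < 1" "\<epsilon> = 2 * a" using assms(6,7) by (auto simp: a_def)
  \<comment> \<open>Since \<open>\<delta> < d\<close> strictly, there is room below the limit. The
    resulting \<open>n0\<close> is fixed before \<open>P\<close>, \<open>k\<close> and
    \<open>m\<close> appear.\<close>
  have "\<forall>\<^sub>F n in sequentially. ?\<gamma> - (d - \<delta>) * a / 2 < mean_lcs p n n / real n"
    using d a by (intro order_tendstoD(1)[OF lim]) simp
  then obtain n0 where n0: "\<And>n. n \<ge> n0 \<Longrightarrow> ?\<gamma> - (d - \<delta>) * a / 2 < mean_lcs p n n / real n"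
    by (auto simp: eventually_sequentially)
  show ?thesis
  proof (intro exI[of _ n0] allI impI conjI; (elim conjE)?)
    fix P :: "'a list \<Rightarrow> 'a list \<Rightarrow> bool" and k m :: nat
    let ?L = "{l::nat. real k * p1 \<le> real l \<and> real l \<le> real k * p2}"
    let ?f = "\<lambda>l. measure M {\<omega> \<in> space M. \<not> P (word X 0 k \<omega>) (word Y 0 l \<omega>)}"
    assume k: "1 \<le> k" and m: "1 \<le> m"
      and bad: "(MAX l \<in> ?L. ?f l) \<le> 1 / (2 * exp 1 * real k) powr (2 / \<epsilon>)"
    \<comment> \<open>Finiteness is what makes \<open>MAX\<close> an upper bound of the individual
      probabilities.\<close>
    have fin: "finite ?L"
    proof (rule finite_subset)
      show "?L \<subseteq> {..nat \<lceil>real k * p2\<rceil>}" by (auto simp: le_nat_iff) linarith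
    qed simp
    have bad_l: "?f l \<le> 1 / (2 * exp 1 * real k) powr (1 / a)"
      if "real k * p1 \<le> real l" "real l \<le> real k * p2" for l
    proof -
      have "?f l \<le> (MAX l \<in> ?L. ?f l)" using fin that by (intro Max_ge) auto
      then show ?thesis using bad by (simp add: a_def)
    qed
    show B: "measure M (B_event M X Y k m P \<epsilon>) \<ge>
      1 - measure M (space M - A_event M X Y k m (\<epsilon> / 2) p1 p2) - exp ((H_e (\<epsilon> / 2) - ln 2) * real m)"
      using prob_B_event_ge[OF k m a(1,2) bad_l] a(3) by simp
    fix n assume n: "n = k * m" "n0 \<le> n"
    have pos: "0 < k * m" using k m by simp
    have "prob (space M - A_event M X Y k m a p1 p2) \<le>
        exp (- real (k * m) * (- (1 + ln (real k)) / real k + \<delta>\<^sup>2 * a\<^sup>2 / 16))"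
    proof (rule prob_not_A_event_le[OF k m a(1) assms(13) _ mean_lcs_le_diagonal[OF star(2,1)] mean_bad])
      show "0 \<le> d" using d(1) assms(13) by simp
      show "(?\<gamma> - (d - \<delta>) * a / 2) * real (k * m) \<le> mean_lcs p (k * m) (k * m)"
        using n0[of "k * m"] n pos by (simp add: pos_less_divide_eq less_imp_le)
    qed
    \<comment> \<open>Substituting \<open>a = \<epsilon> / 2\<close> turns the denominator 16 into
      64.\<close>
    then have "prob (space M - A_event M X Y k m (\<epsilon> / 2) p1 p2) \<le>
        exp (- real n * (- (1 + ln (real k)) / real k + \<delta>\<^sup>2 * \<epsilon>\<^sup>2 / 64))"
      by (simp add: n a_def power_divide)
    moreover have "(H_e (\<epsilon> / 2) - ln 2) * real m = real n / real k * (H_e (\<epsilon> / 2) - ln 2)"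
      using k n by simp
    ultimately show "measure M (B_event M X Y k m P \<epsilon>) \<ge>
      1 - exp (- real n * (- (1 + ln (real k)) / real k + \<delta>\<^sup>2 * \<epsilon>\<^sup>2 / 64))
        - exp (real n / real k * (H_e (\<epsilon> / 2) - ln 2))"
      using B by simp
  qed
qed

end
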